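(* Let $(\Omega,d,\mu)$ be a connected metric space equipped with a separable, non-atomic Borel probability measure $\mu$, which admits a convex isoperimetric estimator (defined in the context), and such that for every $f\in Lip(\Omega)$ and every $c\in\mathbb{R}$ one has $|\nabla f(x)|=0$ a.e. on the set $\{x: f(x)=c\}$. Let $I:[0,1]\to[0,\infty)$ be a convex isoperimetric estimator for $(\Omega,d,\mu)$. Then the following statements are equivalent: 1. (Isoperimetric inequality) For all Borel sets $A\subset\Omega$, $$\mu^{+}(A)\ge I(\mu(A)).$$ 2. (Ledoux's inequality) For all $f\in Lip(\Omega)$, $$\int_{-\infty}^{\infty} I(\mu_f(s))\,ds\le\int_\Omega|\nabla f(x)|\,d\mu.$$ 3. For all $f\in Lip(\Omega)$, the signed decreasing rearrangement $f_\mu^{\bigstar}$ is locally absolutely continuous on $(0,1)$, and for all $t\in(0,1)$ $$\int_0^t\big((-f_\mu^{\bigstar})'(\cdot)\,I(\cdot)\big)^{*}(s)\,ds\le\int_0^t|\nabla f|_\mu^{*}(s)\,ds,$$ where the outer rearrangement $(\cdot)^*$ on the left-hand side is taken with respect to Lebesgue measure on $(0,1)$. 4. (Bobkov's inequality) For all bounded $f\in Lip(\Omega)$ with median value $m(f)=0$, and for all $s>0$, $$\int_\Omega|f(x)|\,d\mu\le\beta_1(s)\int_\Omega|\nabla f(x)|\,d\mu+s\,\mathrm{Osc}_\mu(f),$$ where $\mathrm{Osc}_\mu(f)=\operatorname{ess\,sup}f-\operatorname{ess\,inf}f$ and $\beta_1(s)=\sup_{s<t\le1/2}\frac{t-s}{I(t)}$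 (with the supremum over the empty set equal to $0$).
   Context: $Lip(\Omega)$ is the set of real-valued Lipschitz functions on $\Omega$, and for $f\in Lip(\Omega)$, $|\nabla f(x)|=\limsup_{d(x,y)\to0}\frac{|f(x)-f(y)|}{d(x,y)}$. The perimeter or Minkowski content of a Borel set $A\subset\Omega$ is $\mu^+(A)=\liminf_{h\to0}\frac{\mu(A_h)-\mu(A)}{h}$, where $A_h=\{x\in\Omega:d(x,A)<h\}$. The isoperimetric profile $I_\mu:[0,1]\to[0,\infty)$ is the pointwise maximal function such that $\mu^+(A)\ge I_\mu(\mu(A))$ for all Borel sets $A$. A convex isoperimetric estimator for $(\Omega,d,\mu)$ is a function $I:[0,1]\to[0,\infty)$ that is continuous, convex on $[0,1/2]$, increasing on $(0,1/2)$, symmetric about the point $1/2$, with $I(0)=0$ and $I(t)>0$ on $(0,1)$, and such that $I_\mu(t)\ge I(t)$ for $0\le t\le1$. The space admits a convex isoperimetric estimator if such a function exists. For a $\mu$-measurable, a.e. finite $u$, the distribution function is $\mu_u(t)=\mu\{x:u(x)>t\}$ ($t\in\mathbb{R}$); the decreasing rearrangement is $u_\mu^*(s)=\inf\{t\ge0:\mu_{|u|}(t)\le s\}$; the signed decreasing rearrangement is $u_\mu^{\bigstar}(t)=\inf\{s\in\mathbb{R}:\mu_u(s)\le t\}$. A number $m(f)$ is a median value of $f$ if $\mu\{f\ge m(f)\}\ge1/2$ and $\mu\{f\le m(f)\}\ge1/2$. *)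

theory Defs
  imports "HOL-Probability.Probability"
begin

text \<open>
  The space is the whole of a type of class \<open>metric_space\<close>; a Borel probability measure on it is
  some \<open>M :: 'a measure\<close> with \<open>prob_space M\<close> and \<open>sets M = sets borel\<close>.
\<close>

text \<open>Separability of a finite measure is separability of its measure algebra, i.e. of the
  measurable sets under the pseudometric \<open>(A, B) \<mapsto> \<mu> (A \<Delta> B)\<close>. Every Borel measure
  concentrated on a separable subset of a metric space has this property.\<close>

definition separable_measure :: "'a measure \<Rightarrow> bool" where
  "separable_measure M \<longleftrightarrow>
     (\<exists>\<C>. countable \<C> \<and> \<C> \<subseteq> sets M \<and>
        (\<forall>A\<in>sets M. \<forall>\<epsilon>>0. \<exists>C\<in>\<C>. measure M (sym_diff A C) < \<epsilon>))"

definition nonatomic_measure :: "'a measure \<Rightarrow> bool" where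
  "nonatomic_measure M \<longleftrightarrow>
     (\<forall>A\<in>sets M. 0 < emeasure M A \<longrightarrow>
        (\<exists>B\<in>sets M. B \<subseteq> A \<and> 0 < emeasure M B \<and> emeasure M B < emeasure M A))"

definition Lip :: "('a::metric_space \<Rightarrow> real) set" where
  "Lip = {f. \<exists>C. C-lipschitz_on UNIV f}"

text \<open>The upper limit is taken in the extended reals. For \<open>f \<in> Lip\<close> it is finite and
  nonnegative at every non-isolated point; at an isolated point it is minus infinity, which is
  mapped to \<open>0\<close>.\<close>

definition grad_norm :: "('a::metric_space \<Rightarrow> real) \<Rightarrow> 'a \<Rightarrow> real" where
  "grad_norm f x = real_of_ereal (Limsup (at x) (\<lambda>y. ereal (\<bar>f x - f y\<bar> / dist x y)))"

text \<open>\<open>d(x,A) < h\<close> is spelled out because \<open>infdist x {} = 0\<close>, whereas \<open>d(x,\<emptyset>) = \<infinity>\<close>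
  is meant.\<close>

definition enlargement :: "'a::metric_space set \<Rightarrow> real \<Rightarrow> 'a set" where
  "enlargement A h = {x. \<exists>a\<in>A. dist x a < h}"

definition minkowski_content :: "'a::metric_space measure \<Rightarrow> 'a set \<Rightarrow> ereal" where
  "minkowski_content M A =
     Liminf (at_right 0) (\<lambda>h. ereal ((measure M (enlargement A h) - measure M A) / h))"

text \<open>The supremum is taken in the complete lattice of functions, that is, pointwise. The profile
  takes the value infinity at those \<open>t\<close> for which no Borel set of measure \<open>t\<close> has
  finite perimeter.\<close>

definition isoperimetric_profile :: "'a::metric_space measure \<Rightarrow> real \<Rightarrow> ereal" where
  "isoperimetric_profile M =
     Sup {g. \<forall>A\<in>sets M. g (measure M A) \<le> minkowski_content M A}"

definition convex_isoperimetric_estimator ::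
    "'a::metric_space measure \<Rightarrow> (real \<Rightarrow> real) \<Rightarrow> bool" where
  "convex_isoperimetric_estimator M I \<longleftrightarrow>
     (\<forall>t\<in>{0..1}. 0 \<le> I t) \<and>
     continuous_on {0..1} I \<and>
     convex_on {0..1/2} I \<and>
     mono_on {0<..<1/2} I \<and>
     (\<forall>t\<in>{0..1}. I (1 - t) = I t) \<and>
     I 0 = 0 \<and>
     (\<forall>t\<in>{0<..<1}. 0 < I t) \<and>
     (\<forall>t\<in>{0..1}. ereal (I t) \<le> isoperimetric_profile M t)"

definition distribution_fun :: "'a measure \<Rightarrow> ('a \<Rightarrow> real) \<Rightarrow> real \<Rightarrow> real" where
  "distribution_fun M u t = measure M {x \<in> space M. t < u x}"

text \<open>The value is infinity exactly when the set of admissible \<open>t\<close> is empty, which for a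
  finite measure can only happen for \<open>s \<le> 0\<close>.\<close>

definition decreasing_rearrangement :: "'a measure \<Rightarrow> ('a \<Rightarrow> real) \<Rightarrow> real \<Rightarrow> ennreal" where
  "decreasing_rearrangement M u s =
     (INF t\<in>{t. 0 \<le> t \<and> distribution_fun M (\<lambda>x. \<bar>u x\<bar>) t \<le> s}. ennreal t)"

text \<open>For a probability measure the infimum is over a nonempty set bounded below whenever
  \<open>0 < t < 1\<close>; only such \<open>t\<close> are used.\<close>

definition signed_rearrangement :: "'a measure \<Rightarrow> ('a \<Rightarrow> real) \<Rightarrow> real \<Rightarrow> real" where
  "signed_rearrangement M u t = Inf {s. distribution_fun M u s \<le> t}"

definition absolutely_continuous_on_interval ::
    "real \<Rightarrow> real \<Rightarrow> (real \<Rightarrow> real) \<Rightarrow> bool" where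
  "absolutely_continuous_on_interval a b g \<longleftrightarrow>
     (\<forall>\<epsilon>>0. \<exists>\<delta>>0. \<forall>D::(real \<times> real) set.
        finite D \<and> (\<forall>(u,v)\<in>D. a \<le> u \<and> u \<le> v \<and> v \<le> b) \<and>
        disjoint_family_on (\<lambda>(u,v). {u<..<v}) D \<and> (\<Sum>(u,v)\<in>D. v - u) < \<delta>
        \<longrightarrow> (\<Sum>(u,v)\<in>D. \<bar>g v - g u\<bar>) < \<epsilon>)"

definition locally_absolutely_continuous_01 :: "(real \<Rightarrow> real) \<Rightarrow> bool" where
  "locally_absolutely_continuous_01 g \<longleftrightarrow>
     (\<forall>a b. 0 < a \<and> a \<le> b \<and> b < 1 \<longrightarrow> absolutely_continuous_on_interval a b g)"

definition is_median :: "'a measure \<Rightarrow> ('a \<Rightarrow> real) \<Rightarrow> real \<Rightarrow> bool" where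
  "is_median M f m \<longleftrightarrow>
     1/2 \<le> measure M {x \<in> space M. m \<le> f x} \<and> 1/2 \<le> measure M {x \<in> space M. f x \<le> m}"

text \<open>The essential infimum of \<open>f\<close> is minus the essential supremum of \<open>- f\<close>. Both are
  finite for bounded measurable \<open>f\<close>.\<close>

definition osc :: "'a measure \<Rightarrow> ('a \<Rightarrow> real) \<Rightarrow> real" where
  "osc M f =
     real_of_ereal (esssup M (\<lambda>x. ereal (f x)) - (- esssup M (\<lambda>x. ereal (- f x))))"

definition bobkov_beta :: "(real \<Rightarrow> real) \<Rightarrow> real \<Rightarrow> real" where
  "bobkov_beta I s = (if s < 1/2 then SUP t\<in>{s<..1/2}. (t - s) / I t else 0)"

definition isoperimetric_inequality :: "'a::metric_space measure \<Rightarrow> (real \<Rightarrow> real) \<Rightarrow> bool" where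
  "isoperimetric_inequality M I \<longleftrightarrow>
     (\<forall>A\<in>sets M. ereal (I (measure M A)) \<le> minkowski_content M A)"

definition ledoux_inequality :: "'a::metric_space measure \<Rightarrow> (real \<Rightarrow> real) \<Rightarrow> bool" where
  "ledoux_inequality M I \<longleftrightarrow>
     (\<forall>f\<in>Lip. (\<integral>\<^sup>+s. ennreal (I (distribution_fun M f s)) \<partial>lborel)
               \<le> (\<integral>\<^sup>+x. ennreal (grad_norm f x) \<partial>M))"

definition rearrangement_inequality :: "'a::metric_space measure \<Rightarrow> (real \<Rightarrow> real) \<Rightarrow> bool" where
  "rearrangement_inequality M I \<longleftrightarrow>
     (\<forall>f\<in>Lip. locally_absolutely_continuous_01 (signed_rearrangement M f) \<and>
        (\<forall>t\<in>{0<..<1}.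
           (\<integral>\<^sup>+s\<in>{0<..<t}. decreasing_rearrangement (lebesgue_on {0<..<1})
                 (\<lambda>r. deriv (\<lambda>q. - signed_rearrangement M f q) r * I r) s \<partial>lborel)
           \<le> (\<integral>\<^sup>+s\<in>{0<..<t}. decreasing_rearrangement M (grad_norm f) s \<partial>lborel)))"

text \<open>Both integrands are bounded and Borel measurable for bounded \<open>f \<in> Lip\<close>, so the
  Bochner integrals are genuine.\<close>

definition bobkov_inequality :: "'a::metric_space measure \<Rightarrow> (real \<Rightarrow> real) \<Rightarrow> bool" where
  "bobkov_inequality M I \<longleftrightarrow>
     (\<forall>f\<in>Lip. bounded (range f) \<and> is_median M f 0 \<longrightarrow>
        (\<forall>s>0. (\<integral>x. \<bar>f x\<bar> \<partial>M) \<le> bobkov_beta I s * (\<integral>x. grad_norm f x \<partial>M) + s * osc M f))"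

end

theory Submission
  imports Defs
begin

text \<open>
  A convex isoperimetric estimator \<open>I\<close> lies below the isoperimetric profile, so the isoperimetric
  inequality is part of the assumption on \<open>I\<close>. The equivalences are established by deriving the
  three functional inequalities from it.

  Everything rests on a coarea inequality localised to closed sets \<open>B\<close> of values (lemma
  \<open>coarea\<close>): \<open>\<integral>\<^sub>B I(\<mu>\<^sub>f(s)) ds \<le> \<integral>\<^bsub>{f \<in> B}\<^esub> |\<nabla>f| d\<mu>\<close>. The \<open>h\<close>-enlargement of \<open>{f > s}\<close> is
  \<open>{f\<^sub>h > s}\<close>, where \<open>f\<^sub>h(x)\<close> is the supremum of \<open>f\<close> over the ball of radius \<open>h\<close> about \<open>x\<close>.
  Integrating the isoperimetric inequality for \<open>{f > s}\<close> over \<open>s \<in> B\<close>, Tonelli's theorem turns the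
  difference quotient of measures into the integral of \<open>|B \<inter> [f, f\<^sub>h)| / h\<close>. This is bounded by the
  Lipschitz constant, and its upper limit is at most \<open>|\<nabla>f|\<close> on \<open>{f \<in> B}\<close> and zero elsewhere.
  Fatou's lemma from below and from above gives the claim.

  With \<open>B\<close> the whole line, this is Ledoux's inequality. For Bobkov's inequality, the definition of
  \<open>\<beta>\<^sub>1\<close> gives \<open>t \<le> \<beta>\<^sub>1(s) I(t) + s\<close> for \<open>t \<le> 1/2\<close>. If \<open>0\<close> is a median, then \<open>\<integral> |f|\<close> is the
  integral over the levels \<open>r\<close> of a function of the form \<open>t(r) \<le> 1/2\<close> that vanishes outside an
  interval of length \<open>Osc f\<close> and satisfies \<open>I(t(r)) = I(\<mu>\<^sub>f(r))\<close>; it remains to integrate the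
  inequality for \<open>t(r)\<close> and to apply Ledoux's inequality.

  For the rearrangement inequality write \<open>g\<close> for the signed rearrangement of \<open>f\<close>. The coarea
  inequality on an interval of values shows that \<open>g\<close> is Lipschitz on compact subintervals of
  \<open>(0,1)\<close>, because \<open>I\<close> is bounded away from zero there. A monotone continuous function is
  differentiable almost everywhere (\<open>mono_AE_differentiable\<close>). At points where \<open>g' \<noteq> 0\<close> the function
  \<open>g\<close> is injective with inverse \<open>\<mu>\<^sub>f\<close>, so for a compact set \<open>K\<close> of such points the change of variables
  \<open>r = g(q)\<close> and the coarea inequality on \<open>B = g(K)\<close> give
  \<open>\<integral>\<^sub>K (-g') I \<le> \<integral>\<^bsub>{f \<in> g(K)}\<^esub> |\<nabla>f| d\<mu>\<close>, where \<open>\<mu>{f \<in> g(K)} = |K|\<close> because \<open>g\<close> carries Lebesgue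
  measure to the distribution of \<open>f\<close>. Exhausting \<open>{(-g') I > l}\<close> by such sets \<open>K\<close> yields
  \<open>\<integral> ((-g') I - l)\<^sup>+ \<le> \<integral> (|\<nabla>f| - l)\<^sup>+ d\<mu>\<close> for all \<open>l \<ge> 0\<close>, and this family of inequalities is
  what comparing \<open>\<integral>\<^sub>0\<^sup>t\<close> of the decreasing rearrangements amounts to (\<open>hardy_littlewood_polya\<close>).
\<close>

section \<open>Upper limits as Borel functions\<close>

text \<open>
  Both \<open>grad_norm\<close> and the Dini derivatives of a function on the line are upper limits of
  difference quotients at a moving point. The supremum over a punctured ball of fixed radius is
  lower semicontinuous in the centre, because a \<open>y\<close> that makes the quotient exceed \<open>c\<close> at \<open>x\<close> does
  so at all nearby centres, and the upper limit is a countable infimum of such suprema.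
\<close>

lemma borel_measurable_Limsup_at:
  fixes Q :: "'a::metric_space \<Rightarrow> 'a \<Rightarrow> ereal"
  assumes cont: "\<And>y. continuous_on (- {y}) (\<lambda>x. Q x y)"
  shows "(\<lambda>x. Limsup (at x) (Q x)) \<in> borel_measurable borel"
proof -
  define S where "S n x = (SUP y\<in>ball x (1 / Suc n) - {x}. Q x y)" for n :: nat and x
  have Limsup_eq: "Limsup (at x) (Q x) = (INF n. S n x)" for x
  proof (rule antisym)
    show "Limsup (at x) (Q x) \<le> (INF n. S n x)"
      unfolding Limsup_at S_def by (intro INF_greatest INF_lower) auto
    show "(INF n. S n x) \<le> Limsup (at x) (Q x)"
      unfolding Limsup_at
    proof (rule INF_greatest)
      fix e :: real assume "e \<in> {0<..}"
      then obtain n :: nat where "1 / Suc n < e"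
        using nat_approx_posE by auto
      then have "S n x \<le> (SUP y\<in>ball x e - {x}. Q x y)"
        unfolding S_def by (intro SUP_subset_mono) auto
      then show "(INF n. S n x) \<le> (SUP y\<in>ball x e - {x}. Q x y)"
        by (rule INF_lower2[rotated]) simp
    qed
  qed
  have "S n \<in> borel_measurable borel" for n
  proof (rule borel_measurableI_greater)
    fix c :: ereal
    have "{x. c < S n x} = (\<Union>y. {x \<in> - {y}. c < Q x y} \<inter> ball y (1 / Suc n))"
      by (auto simp: S_def less_SUP_iff dist_commute)
    moreover have "open {x \<in> - {y}. c < Q x y}" for y
    proof -
      have "open ((\<lambda>x. Q x y) -` {c<..} \<inter> - {y})"
        using cont[of y] by (subst (asm) continuous_on_open_vimage) (auto intro: open_Compl)
      also have "(\<lambda>x. Q x y) -` {c<..} \<inter> - {y} = {x \<in> - {y}. c < Q x y}" by auto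
      finally show ?thesis .
    qed
    ultimately have "open {x. c < S n x}"
      by (metis (no_types, lifting) open_Int open_UN open_ball)
    then show "{x \<in> space borel. c < S n x} \<in> sets borel" by simp
  qed
  then show ?thesis unfolding Limsup_eq by measurable
qed

section \<open>The coarea inequality\<close>

lemma Lip_constant:
  assumes "f \<in> Lip"
  shows "\<exists>L\<ge>0. \<forall>x y. \<bar>f x - f y\<bar> \<le> L * dist x y"
  using assms unfolding Lip_def lipschitz_on_def by (auto simp: dist_real_def)

lemma Lip_continuous_on:
  assumes "f \<in> Lip"
  shows "continuous_on A f"
  using assms unfolding Lip_def
  by (auto intro: lipschitz_on_continuous_on lipschitz_on_subset)

lemma Lip_measurable:
  assumes "f \<in> Lip" and "sets M = sets borel"
  shows "f \<in> borel_measurable M"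
  using borel_measurable_continuous_onI[OF Lip_continuous_on[OF assms(1)]] assms(2)
  by (simp cong: measurable_cong_sets)

lemma grad_norm_measurable:
  assumes "f \<in> Lip" and "sets M = sets borel"
  shows "grad_norm f \<in> borel_measurable M"
proof -
  have "(\<lambda>x. Limsup (at x) (\<lambda>y. ereal (\<bar>f x - f y\<bar> / dist x y))) \<in> borel_measurable borel"
    by (intro borel_measurable_Limsup_at continuous_intros Lip_continuous_on assms(1)) auto
  then have "grad_norm f \<in> borel_measurable borel"
    unfolding grad_norm_def by measurable
  then show ?thesis using assms(2) by (simp cong: measurable_cong_sets)
qed

lemma Limsup_slope_le:
  assumes "\<And>x y. \<bar>f x - f y\<bar> \<le> L * dist x y" "0 \<le> L"
  shows "Limsup (at x) (\<lambda>y. ereal (\<bar>f x - f y\<bar> / dist x y)) \<le> ereal L"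
proof (intro Limsup_bounded always_eventually allI)
  fix y show "ereal (\<bar>f x - f y\<bar> / dist x y) \<le> ereal L"
    using assms(1)[of x y] assms(2) by (cases "x = y") (auto simp: divide_le_eq)
qed

lemma grad_norm_nonneg: "0 \<le> grad_norm f x"
proof (cases "at x = bot")
  case True
  then show ?thesis by (simp add: grad_norm_def bot_ereal_def)
next
  case False
  then have "0 \<le> Limsup (at x) (\<lambda>y. ereal (\<bar>f x - f y\<bar> / dist x y))"
    by (intro le_Limsup always_eventually) auto
  then show ?thesis unfolding grad_norm_def by (rule real_of_ereal_pos)
qed

lemma grad_norm_le:
  assumes "\<And>x y. \<bar>f x - f y\<bar> \<le> L * dist x y" "0 \<le> L"
  shows "grad_norm f x \<le> L"
  using Limsup_slope_le[of f L x, OF assms] assms(2) unfolding grad_norm_def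
  by (cases "Limsup (at x) (\<lambda>y. ereal (\<bar>f x - f y\<bar> / dist x y))") auto

text \<open>
  The conversion \<open>real_of_ereal\<close> inside \<open>grad_norm\<close> loses nothing for an upper bound: for a Lipschitz
  function the upper limit is never plus infinity, and minus infinity occurs only at isolated
  points, where the conclusion is vacuous.
\<close>

lemma eventually_slope_less:
  assumes "f \<in> Lip" "grad_norm f x < c"
  shows "\<forall>\<^sub>F y in at x. \<bar>f x - f y\<bar> / dist x y < c"
proof -
  obtain L where L: "0 \<le> L" "\<And>x y. \<bar>f x - f y\<bar> \<le> L * dist x y" using Lip_constant[OF assms(1)] by blast
  let ?l = "Limsup (at x) (\<lambda>y. ereal (\<bar>f x - f y\<bar> / dist x y))"
  have "?l \<le> ereal L" using L by (intro Limsup_slope_le)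
  then have "?l < ereal c" using assms(2) unfolding grad_norm_def by (cases ?l) auto
  then have "\<forall>\<^sub>F y in at x. ereal (\<bar>f x - f y\<bar> / dist x y) < ereal c" by (rule Limsup_lessD)
  then show ?thesis by simp
qed

definition sup_on_ball :: "('a::metric_space \<Rightarrow> real) \<Rightarrow> real \<Rightarrow> 'a \<Rightarrow> real" where
  "sup_on_ball f h x = (SUP y\<in>ball x h. f y)"

context
  fixes f :: "'a::metric_space \<Rightarrow> real" and L h :: real
  assumes L: "\<And>x y. \<bar>f x - f y\<bar> \<le> L * dist x y" "0 \<le> L" and h: "0 < h"
begin

lemma ball_value_le: "y \<in> ball x h \<Longrightarrow> f y \<le> f x + L * h"
  using L(1)[of x y] mult_left_mono[of "dist x y" h L] L(2) by auto

lemma bdd_above_ball: "bdd_above (f ` ball x h)"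
  using ball_value_le by (intro bdd_aboveI2)

lemma sup_on_ball_ge: "f x \<le> sup_on_ball f h x"
  unfolding sup_on_ball_def using h by (intro cSUP_upper bdd_above_ball) auto

lemma sup_on_ball_le: "sup_on_ball f h x \<le> f x + L * h"
  unfolding sup_on_ball_def using h by (intro cSUP_least ball_value_le) auto

lemma less_sup_on_ball_iff: "s < sup_on_ball f h x \<longleftrightarrow> (\<exists>y\<in>ball x h. s < f y)"
  unfolding sup_on_ball_def using h by (intro less_cSUP_iff bdd_above_ball) auto

lemma enlargement_superlevel: "enlargement {x. s < f x} h = {x. s < sup_on_ball f h x}"
  unfolding enlargement_def less_sup_on_ball_iff by auto

lemma sup_on_ball_measurable: "sup_on_ball f h \<in> borel_measurable borel"
proof (rule borel_measurableI_greater)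
  fix s
  have "{x. s < sup_on_ball f h x} = (\<Union>y\<in>{y. s < f y}. ball y h)"
    unfolding less_sup_on_ball_iff by (auto simp: dist_commute)
  then have "open {x. s < sup_on_ball f h x}" by auto
  then show "{x \<in> space borel. s < sup_on_ball f h x} \<in> sets borel" by simp
qed

end

locale isoperimetric_space = prob_space M for M :: "'a::metric_space measure" +
  fixes I :: "real \<Rightarrow> real"
  assumes borel_sets [measurable_cong]: "sets M = sets borel"
    and estimator: "convex_isoperimetric_estimator M I"
begin

lemma space_M [simp]: "space M = UNIV"
  using sets_eq_imp_space_eq[OF borel_sets] by simp

text \<open>
  The set of admissible functions in the definition of the profile is closed under pointwise
  suprema, so the profile itself is admissible.
\<close>

lemma isoperimetric: "isoperimetric_inequality M I"
  unfolding isoperimetric_inequality_def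
proof
  fix A assume A: "A \<in> sets M"
  have "isoperimetric_profile M (measure M A) \<le> minkowski_content M A"
    unfolding isoperimetric_profile_def using A by (auto intro!: SUP_least)
  moreover have "ereal (I (measure M A)) \<le> isoperimetric_profile M (measure M A)"
    using estimator unfolding convex_isoperimetric_estimator_def by auto
  ultimately show "ereal (I (measure M A)) \<le> minkowski_content M A" by (rule order_trans[rotated])
qed

lemma I_nonneg: "0 \<le> t \<Longrightarrow> t \<le> 1 \<Longrightarrow> 0 \<le> I t"
  and I_pos: "0 < t \<Longrightarrow> t < 1 \<Longrightarrow> 0 < I t"
  and I_symmetric: "0 \<le> t \<Longrightarrow> t \<le> 1 \<Longrightarrow> I (1 - t) = I t"
  and I_continuous: "continuous_on {0..1} I"
  using estimator unfolding convex_isoperimetric_estimator_def by auto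

lemma distribution_fun_bounds: "0 \<le> distribution_fun M u s" "distribution_fun M u s \<le> 1"
  by (auto simp: distribution_fun_def)

lemma distribution_fun_antimono:
  assumes [measurable]: "u \<in> borel_measurable M" and "s \<le> s'"
  shows "distribution_fun M u s' \<le> distribution_fun M u s"
  unfolding distribution_fun_def using assms(2) by (intro finite_measure_mono) auto

text \<open>
  Continuity of \<open>I\<close> is only given on \<open>[0,1]\<close>; clamping the argument makes it a continuous function
  on the line that agrees with \<open>I\<close> on the values of a distribution function.
\<close>

lemma I_distribution_measurable [measurable]:
  assumes "u \<in> borel_measurable M"
  shows "(\<lambda>s. I (distribution_fun M u s)) \<in> borel_measurable borel"
proof -
  have "mono (\<lambda>s. - distribution_fun M u s)"
    by (auto intro!: monoI distribution_fun_antimono[OF assms])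
  then have "(\<lambda>s. - (- distribution_fun M u s)) \<in> borel_measurable borel"
    by (intro borel_measurable_uminus borel_measurable_mono)
  then have [measurable]: "(\<lambda>s. distribution_fun M u s) \<in> borel_measurable borel" by simp
  have "continuous_on UNIV (\<lambda>t. I (max 0 (min 1 t)))"
    by (intro continuous_on_compose2[OF I_continuous] continuous_intros) auto
  then have [measurable]: "(\<lambda>t. I (max 0 (min 1 t))) \<in> borel_measurable borel"
    by (rule borel_measurable_continuous_onI)
  have "(\<lambda>s. I (max 0 (min 1 (distribution_fun M u s)))) \<in> borel_measurable borel" by measurable
  moreover have "max 0 (min 1 (distribution_fun M u s)) = distribution_fun M u s" for s
    using distribution_fun_bounds[of u s] by simp
  ultimately show ?thesis by simp
qed

text \<open>
  The isoperimetric inequality for \<open>{f > s}\<close>, along the radii \<open>1 / Suc n\<close> and with the numerator of the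
  difference quotient written as the measure of the shell between \<open>{f > s}\<close> and its enlargement.
  This form is ready for Tonelli's theorem and Fatou's lemma.
\<close>

lemma I_le_liminf_superlevel:
  assumes f: "f \<in> Lip"
  shows "ennreal (I (distribution_fun M f s)) \<le>
    liminf (\<lambda>n. ennreal (Suc n) * emeasure M {x. f x \<le> s \<and> s < sup_on_ball f (1 / Suc n) x})"
proof -
  obtain L where L: "0 \<le> L" "\<And>x y. \<bar>f x - f y\<bar> \<le> L * dist x y" using Lip_constant[OF f] by blast
  have [measurable]: "f \<in> borel_measurable M" using f borel_sets by (rule Lip_measurable)
  let ?A = "{x. s < f x}"
  define q where "q h = (measure M (enlargement ?A h) - measure M ?A) / h" for h
  have A[measurable]: "?A \<in> sets M" using measurable_sets[of f M borel "{s<..}"] by (simp add: vimage_def)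
  have q_eq: "ennreal (q (1 / Suc n)) =
      ennreal (Suc n) * emeasure M {x. f x \<le> s \<and> s < sup_on_ball f (1 / Suc n) x}" for n
  proof -
    have "sup_on_ball f (1 / Suc n) \<in> borel_measurable borel"
      by (rule sup_on_ball_measurable) (use L in auto)
    then have [measurable]: "sup_on_ball f (1 / Suc n) \<in> borel_measurable M" by measurable
    let ?E = "{x. s < sup_on_ball f (1 / Suc n) x}"
    have E: "enlargement ?A (1 / Suc n) = ?E"
      by (rule enlargement_superlevel) (use L in auto)
    have "?E \<in> sets M"
      using measurable_sets[of "sup_on_ball f (1 / Suc n)" M borel "{s<..}"] by (simp add: vimage_def del: of_nat_Suc)
    moreover have "?A \<subseteq> ?E"
      using sup_on_ball_ge[of f L "1 / Suc n"] L by (force intro: less_le_trans)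
    ultimately have "measure M ?E - measure M ?A = measure M (?E - ?A)"
      by (intro finite_measure_Diff[symmetric]) auto
    also have "?E - ?A = {x. f x \<le> s \<and> s < sup_on_ball f (1 / Suc n) x}" by auto
    finally show ?thesis
      unfolding q_def E by (simp add: emeasure_eq_measure ennreal_mult'[symmetric] mult.commute del: of_nat_Suc)
  qed
  have "ereal (I (distribution_fun M f s)) \<le> Liminf (at_right 0) (\<lambda>h. ereal (q h))"
    using isoperimetric A
    unfolding isoperimetric_inequality_def minkowski_content_def q_def distribution_fun_def by simp
  have "ennreal (I (distribution_fun M f s)) \<le> liminf (\<lambda>n. ennreal (q (1 / Suc n)))"
    unfolding le_Liminf_iff
  proof (intro allI impI)
    fix y assume y: "y < ennreal (I (distribution_fun M f s))"
    then obtain c where c: "y = ennreal c" "0 \<le> c" by (cases y) auto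
    with y have "ereal c < ereal (I (distribution_fun M f s))" by (simp add: ennreal_less_iff)
    also note \<open>\<dots> \<le> Liminf (at_right 0) (\<lambda>h. ereal (q h))\<close>
    finally have "\<forall>\<^sub>F h in at_right 0. ereal c < ereal (q h)" by (rule less_LiminfD)
    moreover have "filterlim (\<lambda>n. 1 / real (Suc n)) (at_right 0) sequentially"
      unfolding filterlim_at using LIMSEQ_Suc[OF lim_1_over_n] by (auto simp: eventually_sequentially)
    ultimately have "\<forall>\<^sub>F n in sequentially. c < q (1 / Suc n)"
      by (auto dest: eventually_compose_filterlim)
    then show "\<forall>\<^sub>F n in sequentially. y < ennreal (q (1 / Suc n))"
      by eventually_elim (use c in \<open>simp add: ennreal_less_iff\<close>)
  qed
  then show ?thesis unfolding q_eq .
qed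

text \<open>
  After integration over \<open>s \<in> B\<close>, the shells contribute at each point \<open>x\<close> the quantity
  \<open>W n x = |B \<inter> [f(x), f\<^sub>h(x))| / h\<close> with \<open>h = 1 / Suc n\<close>. That \<open>B\<close> is closed is what makes
  \<open>W n x\<close> vanish eventually when \<open>f x \<notin> B\<close>. Localising in the values of \<open>f\<close> rather than truncating
  \<open>f\<close> keeps the gradient on the right-hand side that of \<open>f\<close> itself.
\<close>

lemma coarea:
  assumes f: "f \<in> Lip" and B: "closed B"
  shows "(\<integral>\<^sup>+s\<in>B. ennreal (I (distribution_fun M f s)) \<partial>lborel)
    \<le> (\<integral>\<^sup>+x. ennreal (grad_norm f x) * indicator B (f x) \<partial>M)"
proof -
  obtain L where L: "0 \<le> L" "\<And>x y. \<bar>f x - f y\<bar> \<le> L * dist x y" using Lip_constant[OF f] by blast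
  have [measurable]: "f \<in> borel_measurable M" using f borel_sets by (rule Lip_measurable)
  have [measurable]: "grad_norm f \<in> borel_measurable M" using f borel_sets by (rule grad_norm_measurable)
  have [measurable]: "B \<in> sets borel" using B by auto
  define F where "F n = sup_on_ball f (1 / Suc n)" for n :: nat
  have "F n \<in> borel_measurable borel" for n
    unfolding F_def by (rule sup_on_ball_measurable) (use L in auto)
  then have [measurable]: "F n \<in> borel_measurable M" for n by measurable
  have F_ge: "f x \<le> F n x" for n x
    unfolding F_def by (rule sup_on_ball_ge) (use L in auto)
  have F_le: "F n x \<le> f x + L * (1 / Suc n)" for n x
    unfolding F_def by (rule sup_on_ball_le) (use L in auto)
  interpret P: pair_sigma_finite lborel M ..
  define W where "W n x = ennreal (Suc n) * emeasure lborel (B \<inter> {f x..<F n x})" for n x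
  have W_eq: "W n x = (\<integral>\<^sup>+s. ennreal (Suc n) * indicator B s * indicator {(s, x). f x \<le> s \<and> s < F n x} (s, x) \<partial>lborel)"
    for n x
  proof -
    have "W n x = (\<integral>\<^sup>+s. ennreal (Suc n) * indicator (B \<inter> {f x..<F n x}) s \<partial>lborel)"
      unfolding W_def by (subst nn_integral_cmult_indicator) auto
    also have "\<dots> = (\<integral>\<^sup>+s. ennreal (Suc n) * indicator B s * indicator {(s, x). f x \<le> s \<and> s < F n x} (s, x) \<partial>lborel)"
      by (intro nn_integral_cong) (auto split: split_indicator)
    finally show ?thesis .
  qed
  have [measurable]: "{(s, x). f x \<le> s \<and> s < F n x} \<in> sets (lborel \<Otimes>\<^sub>M M)" for n
  proof -
    have "{z \<in> space (lborel \<Otimes>\<^sub>M M). f (snd z) \<le> fst z \<and> fst z < F n (snd z)} \<in> sets (lborel \<Otimes>\<^sub>M M)"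
      by measurable
    also have "{z \<in> space (lborel \<Otimes>\<^sub>M M). f (snd z) \<le> fst z \<and> fst z < F n (snd z)}
        = {(s, x). f x \<le> s \<and> s < F n x}"
      by (auto simp: space_pair_measure)
    finally show ?thesis .
  qed
  have W_meas[measurable]: "W n \<in> borel_measurable M" for n
    unfolding W_eq by measurable
  have W_bound: "W n x \<le> ennreal L" for n x
  proof -
    have "W n x \<le> ennreal (Suc n) * emeasure lborel {f x..<F n x}"
      unfolding W_def by (intro mult_left_mono emeasure_mono) auto
    also have "\<dots> = ennreal (Suc n * (F n x - f x))"
      using F_ge[of x n] by (simp add: ennreal_mult'[symmetric] del: of_nat_Suc)
    \<comment> \<open>The increment of the ball supremum is at most \<open>L * h\<close>, which the factor \<open>1 / h\<close> cancels.\<close>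
    also have "\<dots> \<le> ennreal L"
      using F_le[of n x] by (intro ennreal_leI) (simp add: field_simps)
    finally show ?thesis .
  qed
  have W_limsup: "limsup (\<lambda>n. W n x) \<le> ennreal (grad_norm f x) * indicator B (f x)" for x
  proof (cases "f x \<in> B")
    case False
    then obtain e where e: "0 < e" "ball (f x) e \<subseteq> - B"
      using B open_contains_ball[of "- B"] by (auto simp: open_Compl)
    have "\<forall>\<^sub>F n in sequentially. L * (1 / Suc n) < e"
    proof -
      have "(\<lambda>n. L * (1 / real (Suc n))) \<longlonglongrightarrow> L * 0"
        by (intro tendsto_intros LIMSEQ_Suc[OF lim_1_over_n])
      then show ?thesis using e(1) by (auto dest: order_tendstoD(2))
    qed
    then have "\<forall>\<^sub>F n in sequentially. W n x \<le> 0"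
    proof eventually_elim
      case (elim n)
      have "{f x..<F n x} \<subseteq> ball (f x) e"
        using F_le[of n x] elim by (auto simp: dist_real_def)
      then have "B \<inter> {f x..<F n x} = {}" using e(2) by auto
      then show ?case unfolding W_def by simp
    qed
    then have "limsup (\<lambda>n. W n x) \<le> 0" by (rule Limsup_bounded)
    then show ?thesis by (simp add: False)
  next
    case True
    have "limsup (\<lambda>n. W n x) \<le> ennreal (grad_norm f x) + ennreal e" if "0 < e" for e
    proof -
      let ?c = "grad_norm f x + e"
      have "0 < ?c" using grad_norm_nonneg[of f x] that by simp
      \<comment> \<open>Once all slopes at \<open>x\<close> within distance \<open>h\<close> are below \<open>?c\<close>, so is \<open>(F n x - f x) / h\<close>.\<close>
      have "\<forall>\<^sub>F y in at x. \<bar>f x - f y\<bar> / dist x y < ?c"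
        using f that by (intro eventually_slope_less) auto
      then obtain d where d: "0 < d"
        "\<And>y. y \<noteq> x \<Longrightarrow> dist y x < d \<Longrightarrow> \<bar>f x - f y\<bar> / dist x y < ?c"
        unfolding eventually_at by auto
      have "\<forall>\<^sub>F n in sequentially. 1 / real (Suc n) < d"
        using order_tendstoD(2)[OF LIMSEQ_Suc[OF lim_1_over_n] d(1)] by simp
      then have "\<forall>\<^sub>F n in sequentially. W n x \<le> ennreal ?c"
      proof eventually_elim
        case (elim n)
        have "F n x \<le> f x + ?c * (1 / Suc n)"
          unfolding F_def sup_on_ball_def
        proof (rule cSUP_least)
          fix y assume y: "y \<in> ball x (1 / Suc n)"
          show "f y \<le> f x + ?c * (1 / Suc n)"
          proof (cases "y = x")
            case False
            then have "\<bar>f x - f y\<bar> / dist x y < ?c"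
              using y elim by (intro d(2)) (auto simp: dist_commute)
            then have "\<bar>f x - f y\<bar> \<le> ?c * dist x y"
              using False by (simp add: divide_less_eq)
            also have "\<dots> \<le> ?c * (1 / Suc n)"
              using y \<open>0 < ?c\<close> by (intro mult_left_mono) auto
            finally show ?thesis by auto
          qed (use \<open>0 < ?c\<close> in simp)
        qed simp
        then have "Suc n * (F n x - f x) \<le> ?c" by (simp add: field_simps)
        moreover have "W n x \<le> ennreal (Suc n * (F n x - f x))"
        proof -
          have "W n x \<le> ennreal (Suc n) * emeasure lborel {f x..<F n x}"
            unfolding W_def by (intro mult_left_mono emeasure_mono) auto
          then show ?thesis using F_ge[of x n] by (simp add: ennreal_mult'[symmetric] del: of_nat_Suc)
        qed
        ultimately show ?case by (meson ennreal_leI order_trans)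
      qed
      then have "limsup (\<lambda>n. W n x) \<le> ennreal ?c" by (rule Limsup_bounded)
      then show ?thesis using that grad_norm_nonneg[of f x] by simp
    qed
    then have "limsup (\<lambda>n. W n x) \<le> ennreal (grad_norm f x)"
      by (rule ennreal_le_epsilon)
    then show ?thesis by (simp add: True)
  qed
  have "(\<integral>\<^sup>+s\<in>B. ennreal (I (distribution_fun M f s)) \<partial>lborel) \<le>
      (\<integral>\<^sup>+s. liminf (\<lambda>n. \<integral>\<^sup>+x. ennreal (Suc n) * indicator B s * indicator {(s, x). f x \<le> s \<and> s < F n x} (s, x) \<partial>M) \<partial>lborel)"
  proof (intro nn_integral_mono)
    fix s
    show "ennreal (I (distribution_fun M f s)) * indicator B s \<le>
        liminf (\<lambda>n. \<integral>\<^sup>+x. ennreal (Suc n) * indicator B s * indicator {(s, x). f x \<le> s \<and> s < F n x} (s, x) \<partial>M)"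
    proof (cases "s \<in> B")
      case True
      have "(\<integral>\<^sup>+x. ennreal (Suc n) * indicator B s * indicator {(s, x). f x \<le> s \<and> s < F n x} (s, x) \<partial>M)
          = ennreal (Suc n) * emeasure M {x. f x \<le> s \<and> s < F n x}" for n
      proof -
        have "{x \<in> space M. f x \<le> s \<and> s < F n x} \<in> sets M" by measurable
        then have *: "{x. f x \<le> s \<and> s < F n x} \<in> sets M" by simp
        have "(\<integral>\<^sup>+x. ennreal (Suc n) * indicator B s * indicator {(s, x). f x \<le> s \<and> s < F n x} (s, x) \<partial>M)
          = (\<integral>\<^sup>+x. ennreal (Suc n) * indicator {x. f x \<le> s \<and> s < F n x} x \<partial>M)"
          using True by (intro nn_integral_cong) (auto split: split_indicator)
        then show ?thesis using * by (simp add: nn_integral_cmult_indicator)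
      qed
      then show ?thesis using I_le_liminf_superlevel[OF f, of s] True unfolding F_def by simp
    qed simp
  qed
  also have "\<dots> \<le> liminf (\<lambda>n. \<integral>\<^sup>+s. \<integral>\<^sup>+x. ennreal (Suc n) * indicator B s * indicator {(s, x). f x \<le> s \<and> s < F n x} (s, x) \<partial>M \<partial>lborel)"
    by (intro nn_integral_liminf) measurable
  also have "\<dots> = liminf (\<lambda>n. \<integral>\<^sup>+x. W n x \<partial>M)"
    unfolding W_eq by (subst P.Fubini') auto
  also have "\<dots> \<le> limsup (\<lambda>n. \<integral>\<^sup>+x. W n x \<partial>M)"
    by (intro Liminf_le_Limsup) auto
  also have "\<dots> \<le> (\<integral>\<^sup>+x. limsup (\<lambda>n. W n x) \<partial>M)"
    by (rule nn_integral_limsup[where w = "\<lambda>_. ennreal L"]) (auto simp: W_bound emeasure_space_1[unfolded space_M])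
  also have "\<dots> \<le> (\<integral>\<^sup>+x. ennreal (grad_norm f x) * indicator B (f x) \<partial>M)"
    by (intro nn_integral_mono W_limsup)
  finally show ?thesis .
qed

theorem ledoux: "ledoux_inequality M I"
  unfolding ledoux_inequality_def
proof
  fix f :: "'a \<Rightarrow> real" assume "f \<in> Lip"
  from coarea[OF this, of UNIV]
  show "(\<integral>\<^sup>+s. ennreal (I (distribution_fun M f s)) \<partial>lborel) \<le> (\<integral>\<^sup>+x. ennreal (grad_norm f x) \<partial>M)"
    by simp
qed

end

section \<open>Bobkov's inequality\<close>

context isoperimetric_space
begin

text \<open>
  The supremum in \<open>bobkov_beta\<close> is taken in the reals, so it is meaningful only once it is known to be
  over a bounded set. It is: for \<open>s > 0\<close> the quotient is continuous on the compact interval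
  \<open>[s, 1/2]\<close>, where \<open>I\<close> is positive.
\<close>

lemma bobkov_beta_bounds:
  assumes s: "0 < s"
  shows "0 \<le> bobkov_beta I s"
    and "0 \<le> t \<Longrightarrow> t \<le> 1/2 \<Longrightarrow> t \<le> bobkov_beta I s * I t + s"
proof -
  have le: "(t - s) / I t \<le> bobkov_beta I s" if "s < t" "t \<le> 1/2" for t
  proof -
    have "I t \<noteq> 0" if "t \<in> {s..1/2}" for t using I_pos[of t] s that by auto
    then have "continuous_on {s..1/2} (\<lambda>t. (t - s) / I t)"
      using s by (intro continuous_intros continuous_on_subset[OF I_continuous]) auto
    then have "bdd_above ((\<lambda>t. (t - s) / I t) ` {s..1/2})"
      by (intro bounded_imp_bdd_above compact_imp_bounded compact_continuous_image) auto
    then have "bdd_above ((\<lambda>t. (t - s) / I t) ` {s<..1/2})"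
      by (rule bdd_above_mono) auto
    then show ?thesis
      using that unfolding bobkov_beta_def by (auto intro!: cSUP_upper)
  qed
  show nonneg: "0 \<le> bobkov_beta I s"
  proof (cases "s < 1/2")
    case True
    have "0 \<le> (1/2 - s) / I (1/2)" using True I_pos[of "1/2"] by simp
    also have "\<dots> \<le> bobkov_beta I s" using True by (intro le) auto
    finally show ?thesis .
  qed (simp add: bobkov_beta_def)
  show "t \<le> bobkov_beta I s * I t + s" if "0 \<le> t" "t \<le> 1/2"
  proof (cases "s < t")
    case True
    then have "0 < I t" using s that by (intro I_pos) auto
    then show ?thesis using le[OF True that(2)] by (simp add: divide_le_eq)
  next
    case False
    moreover have "0 \<le> bobkov_beta I s * I t"
      using nonneg I_nonneg[of t] that by simp
    ultimately show ?thesis by simp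
  qed
qed

text \<open>
  Finiteness and sign of the essential supremum, needed to undo the extended reals in \<open>osc\<close>.
  The positivity hypothesis will come from the median being zero.
\<close>

lemma esssup_real:
  assumes [measurable]: "f \<in> borel_measurable M" and K: "\<And>x. f x \<le> K"
    and pos: "0 < measure M {x \<in> space M. 0 \<le> f x}"
  obtains a where "0 \<le> a" "esssup M (\<lambda>x. ereal (f x)) = ereal a" "AE x in M. f x \<le> a"
proof -
  let ?e = "esssup M (\<lambda>x. ereal (f x))"
  have AE: "AE x in M. ereal (f x) \<le> ?e" by (rule esssup_AE)
  have "?e \<le> ereal K" using K by (intro esssup_I) auto
  moreover have "0 \<le> ?e"
  proof (rule ccontr)
    assume neg: "\<not> 0 \<le> ?e"
    from AE have "AE x in M. \<not> 0 \<le> f x"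
    proof eventually_elim
      case (elim x)
      have "ereal (f x) < 0" by (rule le_less_trans[OF elim]) (use neg in simp)
      then show ?case by simp
    qed
    then have "measure M {x \<in> space M. 0 \<le> f x} = 0"
      by (subst prob_eq_0) auto
    with pos show False by simp
  qed
  ultimately obtain a where a: "?e = ereal a" "0 \<le> a" by (cases ?e) auto
  show thesis using that[OF a(2,1)] AE unfolding a(1) by simp
qed

text \<open>
  Positive levels count the part of \<open>f\<close> above the level, negative ones the part below. Thus both
  halves are expressed by one distribution function, as in Ledoux's inequality.
\<close>

lemma nn_integral_abs_layer_cake:
  assumes [measurable]: "f \<in> borel_measurable M"
  shows "(\<integral>\<^sup>+x. ennreal \<bar>f x\<bar> \<partial>M) = (\<integral>\<^sup>+r. ennreal
    (if 0 \<le> r then distribution_fun M f r else 1 - distribution_fun M f r) \<partial>lborel)"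
proof -
  interpret P: pair_sigma_finite lborel M ..
  define S where "S = {(r, x). 0 \<le> r \<and> r < f x \<or> r < 0 \<and> f x \<le> r}"
  have "{z \<in> space (lborel \<Otimes>\<^sub>M M). 0 \<le> fst z \<and> fst z < f (snd z) \<or> fst z < 0 \<and> f (snd z) \<le> fst z}
      \<in> sets (lborel \<Otimes>\<^sub>M M)" by measurable
  also have "{z \<in> space (lborel \<Otimes>\<^sub>M M). 0 \<le> fst z \<and> fst z < f (snd z) \<or> fst z < 0 \<and> f (snd z) \<le> fst z} = S"
    by (auto simp: space_pair_measure S_def)
  finally have S[measurable]: "S \<in> sets (lborel \<Otimes>\<^sub>M M)" .
  have "ennreal \<bar>f x\<bar> = (\<integral>\<^sup>+r. indicator S (r, x) \<partial>lborel)" for x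
  proof -
    have "(\<integral>\<^sup>+r. indicator S (r, x) \<partial>lborel) = (\<integral>\<^sup>+r. indicator ({0..<f x} \<union> {f x..<0}) r \<partial>lborel)"
      by (intro nn_integral_cong) (auto simp: S_def split: split_indicator)
    also have "\<dots> = ennreal \<bar>f x\<bar>" by (cases "0 \<le> f x") auto
    finally show ?thesis by simp
  qed
  then have "(\<integral>\<^sup>+x. ennreal \<bar>f x\<bar> \<partial>M) = (\<integral>\<^sup>+x. \<integral>\<^sup>+r. indicator S (r, x) \<partial>lborel \<partial>M)" by simp
  also have "\<dots> = (\<integral>\<^sup>+r. \<integral>\<^sup>+x. indicator S (r, x) \<partial>M \<partial>lborel)"
    by (subst P.Fubini') auto
  also have "\<dots> = (\<integral>\<^sup>+r. ennreal
    (if 0 \<le> r then distribution_fun M f r else 1 - distribution_fun M f r) \<partial>lborel)"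
  proof (rule nn_integral_cong)
    fix r
    show "(\<integral>\<^sup>+x. indicator S (r, x) \<partial>M) =
      ennreal (if 0 \<le> r then distribution_fun M f r else 1 - distribution_fun M f r)"
    proof -
      let ?A = "{x \<in> space M. r < f x}"
      have A: "?A \<in> sets M" by measurable
      have "(\<integral>\<^sup>+x. indicator S (r, x) \<partial>M) = (\<integral>\<^sup>+x. indicator (if 0 \<le> r then ?A else space M - ?A) x \<partial>M)"
        by (intro nn_integral_cong) (auto simp: S_def split: split_indicator)
      also have "\<dots> = emeasure M (if 0 \<le> r then ?A else space M - ?A)"
        using A by (intro nn_integral_indicator) auto
      also have "\<dots> = ennreal (if 0 \<le> r then distribution_fun M f r else 1 - distribution_fun M f r)"
        unfolding distribution_fun_def using prob_compl[OF A] by (auto simp: emeasure_eq_measure)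
      finally show ?thesis .
    qed
  qed
  finally show ?thesis .
qed

text \<open>
  Since \<open>0\<close> is a median, the integrand \<open>t\<close> of the layer-cake formula is at most \<open>1/2\<close> at each level,
  so \<open>t \<le> \<beta>\<^sub>1(s) I(t) + s\<close> applies; the symmetry of \<open>I\<close> allows \<open>I(t)\<close> to be replaced by
  \<open>I(\<mu>\<^sub>f(r))\<close> at negative levels. The term \<open>s\<close> is needed only at levels between the
  essential infimum and the essential supremum, since \<open>t = 0\<close> at the others.
\<close>

theorem bobkov: "bobkov_inequality M I"
  unfolding bobkov_inequality_def
proof (intro ballI allI impI)
  fix f :: "'a \<Rightarrow> real" and s :: real
  assume f: "f \<in> Lip" and bm: "bounded (range f) \<and> is_median M f 0" and s: "0 < s"
  obtain K where K: "\<And>x. \<bar>f x\<bar> \<le> K" using bm by (auto simp: bounded_iff)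
  obtain L where L: "0 \<le> L" "\<And>x y. \<bar>f x - f y\<bar> \<le> L * dist x y" using Lip_constant[OF f] by blast
  have fm[measurable]: "f \<in> borel_measurable M" using f borel_sets by (rule Lip_measurable)
  have [measurable]: "grad_norm f \<in> borel_measurable M" using f borel_sets by (rule grad_norm_measurable)
  have median: "1/2 \<le> measure M {x \<in> space M. 0 \<le> f x}" "1/2 \<le> measure M {x \<in> space M. f x \<le> 0}"
    using bm unfolding is_median_def by auto
  obtain a where a: "0 \<le> a" "esssup M (\<lambda>x. ereal (f x)) = ereal a" "AE x in M. f x \<le> a"
    by (rule esssup_real[of f K]) (use K median abs_le_D1 in \<open>auto intro: less_le_trans[rotated]\<close>)
  obtain b where b: "0 \<le> b" "esssup M (\<lambda>x. ereal (- f x)) = ereal b" "AE x in M. - f x \<le> b"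
    by (rule esssup_real[of "\<lambda>x. - f x" K]) (use K median abs_le_D2 in \<open>auto intro: less_le_trans[rotated]\<close>)
  have osc: "osc M f = a + b" unfolding osc_def a(2) b(2) by simp
  let ?\<beta> = "bobkov_beta I s" and ?\<phi> = "distribution_fun M f"
  have le: "ennreal (if 0 \<le> r then ?\<phi> r else 1 - ?\<phi> r) \<le>
      ennreal ?\<beta> * ennreal (I (?\<phi> r)) + ennreal s * indicator {-b..a} r" for r
  proof -
    define t where "t = (if 0 \<le> r then ?\<phi> r else 1 - ?\<phi> r)"
    have compl: "1 - ?\<phi> r = measure M {x \<in> space M. f x \<le> r}"
    proof -
      have "{x \<in> space M. f x \<le> r} = space M - {x \<in> space M. r < f x}" by auto
      then show ?thesis unfolding distribution_fun_def by (simp add: prob_compl[symmetric])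
    qed
    have "t \<le> 1/2"
    proof (cases "0 \<le> r")
      case True
      have "measure M {x \<in> space M. f x \<le> 0} \<le> measure M {x \<in> space M. f x \<le> r}"
        using True by (intro finite_measure_mono) auto
      then show ?thesis using median compl True unfolding t_def by simp
    next
      case False
      have "measure M {x \<in> space M. 0 \<le> f x} \<le> ?\<phi> r"
        unfolding distribution_fun_def using False by (intro finite_measure_mono) auto
      then show ?thesis using median False unfolding t_def by simp
    qed
    moreover have t0: "0 \<le> t" using distribution_fun_bounds[of f r] by (simp add: t_def)
    ultimately have "t \<le> ?\<beta> * I t + s" by (intro bobkov_beta_bounds s)
    moreover have It: "I t = I (?\<phi> r)"
      using I_symmetric[of "?\<phi> r"] distribution_fun_bounds[of f r] by (simp add: t_def)
    moreover have "t = 0" if "r \<notin> {-b..a}"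
    proof (cases "0 \<le> r")
      case True
      then have "a < r" using that b(1) by auto
      then have "AE x in M. \<not> r < f x" using a(3) by (auto elim: eventually_mono)
      then have "?\<phi> r = 0" unfolding distribution_fun_def by (subst prob_eq_0) auto
      then show ?thesis using True by (simp add: t_def)
    next
      case False
      then have "r < - b" using that a(1) by auto
      then have "AE x in M. \<not> f x \<le> r" using b(3) by (auto elim: eventually_mono)
      then have "1 - ?\<phi> r = 0" unfolding compl by (subst prob_eq_0) auto
      then show ?thesis using False by (simp add: t_def)
    qed
    moreover have "0 \<le> I (?\<phi> r)" using distribution_fun_bounds[of f r] by (intro I_nonneg)
    ultimately show ?thesis
      using bobkov_beta_bounds(1)[OF s] s t0 unfolding t_def[symmetric]
      by (cases "r \<in> {-b..a}")
        (auto simp: ennreal_mult'[symmetric] ennreal_plus[symmetric] simp del: ennreal_plus intro!: ennreal_leI)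
  qed
  have "ennreal (\<integral>x. \<bar>f x\<bar> \<partial>M) = (\<integral>\<^sup>+x. ennreal \<bar>f x\<bar> \<partial>M)"
    using K by (intro nn_integral_eq_integral[symmetric] integrable_const_bound[of _ K]) auto
  also have "\<dots> = (\<integral>\<^sup>+r. ennreal (if 0 \<le> r then ?\<phi> r else 1 - ?\<phi> r) \<partial>lborel)"
    by (rule nn_integral_abs_layer_cake) measurable
  also have "\<dots> \<le> (\<integral>\<^sup>+r. ennreal ?\<beta> * ennreal (I (?\<phi> r)) + ennreal s * indicator {-b..a} r \<partial>lborel)"
    by (intro nn_integral_mono le)
  also have "\<dots> = ennreal ?\<beta> * (\<integral>\<^sup>+r. ennreal (I (?\<phi> r)) \<partial>lborel) + ennreal s * emeasure lborel {-b..a}"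
    using I_distribution_measurable[OF fm]
    by (subst nn_integral_add) (auto simp: nn_integral_cmult)
  also have "\<dots> \<le> ennreal ?\<beta> * (\<integral>\<^sup>+x. ennreal (grad_norm f x) \<partial>M) + ennreal s * ennreal (a + b)"
    using ledoux f a(1) b(1) unfolding ledoux_inequality_def by (intro add_mono mult_left_mono) auto
  also have "(\<integral>\<^sup>+x. ennreal (grad_norm f x) \<partial>M) = ennreal (\<integral>x. grad_norm f x \<partial>M)"
    using grad_norm_le[of f L, OF L(2,1)] grad_norm_nonneg[of f]
    by (intro nn_integral_eq_integral integrable_const_bound[of _ L]) auto
  finally have "ennreal (\<integral>x. \<bar>f x\<bar> \<partial>M) \<le>
    ennreal ?\<beta> * ennreal (\<integral>x. grad_norm f x \<partial>M) + ennreal s * ennreal (a + b)" .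
  moreover have nonneg: "0 \<le> ?\<beta> * (\<integral>x. grad_norm f x \<partial>M)" "0 \<le> s * (a + b)"
    using bobkov_beta_bounds(1)[OF s] s a(1) b(1) grad_norm_nonneg[of f]
    by (auto intro!: mult_nonneg_nonneg integral_nonneg)
  ultimately have "ennreal (\<integral>x. \<bar>f x\<bar> \<partial>M) \<le> ennreal (?\<beta> * (\<integral>x. grad_norm f x \<partial>M) + s * (a + b))"
    using bobkov_beta_bounds(1)[OF s] s by (simp add: ennreal_mult')
  then show "(\<integral>x. \<bar>f x\<bar> \<partial>M) \<le> ?\<beta> * (\<integral>x. grad_norm f x \<partial>M) + s * osc M f"
    unfolding osc using nonneg by (subst (asm) ennreal_le_iff) auto
qed

end

section \<open>Differentiability of monotone functions\<close>

text \<open>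
  Vitali's covering theorem on the line, with the intervals named by their endpoints and kept
  inside a prescribed open set. The property \<open>P\<close> will be a bound on the slope of a function over the
  interval.
\<close>

lemma vitali_interval_cover:
  fixes E U :: "real set"
  assumes "open U" "E \<subseteq> U"
    and fine: "\<And>x d. x \<in> E \<Longrightarrow> 0 < d \<Longrightarrow> \<exists>a b. a < b \<and> b - a < d \<and> a \<le> x \<and> x \<le> b \<and> P a b"
  obtains C :: "(real \<times> real) set" where "countable C"
    "\<And>a b. (a, b) \<in> C \<Longrightarrow> a < b \<and> {a..b} \<subseteq> U \<and> P a b"
    "disjoint_family_on (\<lambda>(a, b). {a..b}) C"
    "negligible (E - (\<Union>(a, b)\<in>C. {a..b}))"
proof -
  define K where "K = {(a, b). a < b \<and> {a..b} \<subseteq> U \<and> P a b}"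
  define cent where "cent = (\<lambda>(a, b). (a + b) / 2 :: real)"
  define rad where "rad = (\<lambda>(a, b). (b - a) / 2 :: real)"
  have cball: "cball (cent i) (rad i) = (\<lambda>(a, b). {a..b}) i" for i
    by (auto simp: cent_def rad_def cball_eq_atLeastAtMost split: prod.split) (auto simp: field_simps)
  obtain C where C: "countable C" "C \<subseteq> K"
    "pairwise (\<lambda>i j. disjnt (cball (cent i) (rad i)) (cball (cent j) (rad j))) C"
    "negligible (E - (\<Union>i\<in>C. cball (cent i) (rad i)))"
  proof (rule Vitali_covering_theorem_cballs[of K rad E cent])
    show "0 < rad i" if "i \<in> K" for i using that by (auto simp: K_def rad_def)
    fix x d :: real assume x: "x \<in> E" "0 < d"
    then obtain e where e: "0 < e" "ball x e \<subseteq> U"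
      using assms(1,2) by (meson open_contains_ball subsetD)
    obtain a b where ab: "a < b" "b - a < min d e" "a \<le> x" "x \<le> b" "P a b"
      using fine[of x "min d e"] x e by auto
    have "{a..b} \<subseteq> ball x e" using ab by (auto simp: dist_real_def)
    then have "(a, b) \<in> K" using ab e by (auto simp: K_def)
    moreover have "x \<in> cball (cent (a, b)) (rad (a, b))" unfolding cball using ab by auto
    moreover have "rad (a, b) < d" using ab x by (auto simp: rad_def)
    ultimately show "\<exists>i. i \<in> K \<and> x \<in> cball (cent i) (rad i) \<and> rad i < d" by blast
  qed auto
  show thesis
  proof (rule that[OF C(1)])
    show "a < b \<and> {a..b} \<subseteq> U \<and> P a b" if "(a, b) \<in> C" for a b
      using C(2) that by (auto simp: K_def)
    show "disjoint_family_on (\<lambda>(a, b). {a..b}) C"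
      using C(3) unfolding cball disjoint_family_on_def pairwise_def disjnt_def by auto
    show "negligible (E - (\<Union>(a, b)\<in>C. {a..b}))"
      using C(4) unfolding cball .
  qed
qed

lemma emeasure_intervals_mono:
  fixes \<alpha> \<beta> :: "real measure"
  assumes C: "countable C" "disjoint_family_on (\<lambda>(a, b). {a..b}) C"
    and sets: "sets \<alpha> = sets borel" "sets \<beta> = sets borel"
    and le: "\<And>a b. (a, b) \<in> C \<Longrightarrow> emeasure \<alpha> {a..b} \<le> emeasure \<beta> {a..b}"
  shows "emeasure \<alpha> (\<Union>(a, b)\<in>C. {a..b}) \<le> emeasure \<beta> (\<Union>(a, b)\<in>C. {a..b})"
proof -
  have eq: "emeasure N (\<Union>i\<in>C. (\<lambda>(a, b). {a..b}) i) =
      (\<integral>\<^sup>+i. emeasure N ((\<lambda>(a, b). {a..b}) i) \<partial>count_space C)"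
    if "sets N = sets borel" for N :: "real measure"
  proof (rule emeasure_UN_countable)
    show "(\<lambda>(a, b). {a..b}) i \<in> sets N" if "i \<in> C" for i
      unfolding \<open>sets N = sets borel\<close> by (cases i) simp
  qed (fact C)+
  show ?thesis
    unfolding eq[OF sets(1)] eq[OF sets(2)]
  proof (rule nn_integral_mono)
    fix i assume "i \<in> space (count_space C)"
    then show "emeasure \<alpha> (case i of (a, b) \<Rightarrow> {a..b}) \<le> emeasure \<beta> (case i of (a, b) \<Rightarrow> {a..b})"
      using le[of "fst i" "snd i"] by (simp add: case_prod_beta)
  qed
qed

text \<open>
  If intervals of slope at least \<open>q\<close> shrink to each point of \<open>E\<close>, then disjoint ones inside an open
  \<open>U \<supseteq> E\<close> fill up \<open>E\<close>, whence \<open>q |E| \<le> \<nu>(U)\<close> for the Stieltjes measure \<open>\<nu>\<close> of \<open>G\<close>. Outer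
  regularity of the finite measure \<open>\<nu>\<close> replaces \<open>U\<close> by \<open>E\<close>.
\<close>

lemma interval_measure_ge_slope:
  fixes G :: "real \<Rightarrow> real"
  assumes G: "mono G" "continuous_on UNIV G" and fin: "emeasure (interval_measure G) UNIV \<noteq> \<infinity>"
    and E: "E \<in> sets borel" and q: "0 \<le> q"
    and fine: "\<And>x d. x \<in> E \<Longrightarrow> 0 < d \<Longrightarrow>
        \<exists>a b. a < b \<and> b - a < d \<and> a \<le> x \<and> x \<le> b \<and> q * (b - a) \<le> G b - G a"
  shows "ennreal q * emeasure lborel E \<le> emeasure (interval_measure G) E"
proof -
  let ?\<nu> = "interval_measure G"
  have "emeasure ?\<nu> E = (INF U\<in>{U. E \<subseteq> U \<and> open U}. emeasure ?\<nu> U)"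
    using fin E by (intro outer_regular) auto
  also have "\<dots> \<ge> ennreal q * emeasure lborel E"
  proof (intro INF_greatest, clarify)
    fix U assume U: "E \<subseteq> U" "open U"
    obtain C where C: "countable C"
      "\<And>a b. (a, b) \<in> C \<Longrightarrow> a < b \<and> {a..b} \<subseteq> U \<and> q * (b - a) \<le> G b - G a"
      "disjoint_family_on (\<lambda>(a, b). {a..b}) C"
      "negligible (E - (\<Union>(a, b)\<in>C. {a..b}))"
    proof (rule vitali_interval_cover[OF U(2,1), of "\<lambda>a b. q * (b - a) \<le> G b - G a"])
      fix x d :: real assume "x \<in> E" "0 < d"
      then show "\<exists>a b. a < b \<and> b - a < d \<and> a \<le> x \<and> x \<le> b \<and> q * (b - a) \<le> G b - G a"
        by (rule fine)
    qed (rule that)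
    let ?V = "\<Union>(a, b)\<in>C. {a..b}"
    have V[measurable]: "?V \<in> sets borel" using C(1) by (intro sets.countable_UN'') auto
    have [measurable]: "E \<in> sets borel" by fact
    have "E - ?V \<in> null_sets lborel"
      using C(4) E V by (auto simp: negligible_iff_null_sets null_sets_completion_iff)
    then have "emeasure lborel E \<le> emeasure lborel (E \<union> ?V)"
      by (intro emeasure_mono) auto
    also have "\<dots> = emeasure lborel (?V \<union> (E - ?V))" by (simp add: Un_commute)
    also have "\<dots> = emeasure lborel ?V"
      using \<open>E - ?V \<in> null_sets lborel\<close> by (intro emeasure_Un_null_set) auto
    finally have "ennreal q * emeasure lborel E \<le> emeasure (scale_measure (ennreal q) lborel) ?V"
      by (simp add: mult_left_mono)
    also have "\<dots> \<le> emeasure ?\<nu> ?V"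
    proof (intro emeasure_intervals_mono C)
      fix a b assume ab: "(a, b) \<in> C"
      then have "emeasure ?\<nu> {a..b} = G b - G a"
        using C(2)[OF ab] G by (intro emeasure_interval_measure_Icc) (auto simp: mono_def)
      then show "emeasure (scale_measure (ennreal q) lborel) {a..b} \<le> emeasure ?\<nu> {a..b}"
        using C(2)[OF ab] q by (auto simp: ennreal_mult'[symmetric] intro!: ennreal_leI)
    qed auto
    also have "\<dots> \<le> emeasure ?\<nu> U"
      using C(2) U by (intro emeasure_mono) auto
    finally show "ennreal q * emeasure lborel E \<le> emeasure ?\<nu> U" .
  qed
  finally show ?thesis .
qed

text \<open>
  The counterpart for small slopes cannot bound \<open>\<nu>(E)\<close>, because the part of \<open>E\<close> missed by the
  covering is null only for Lebesgue measure and \<open>\<nu>\<close> may have a singular part. It bounds \<open>\<nu>(V)\<close> for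
  the union \<open>V\<close> of the covering intervals instead.
\<close>

lemma interval_measure_le_slope:
  fixes G :: "real \<Rightarrow> real"
  assumes G: "mono G" "continuous_on UNIV G"
    and U: "open U" "E \<subseteq> U" and E: "E \<in> sets borel"
    and fine: "\<And>x d. x \<in> E \<Longrightarrow> 0 < d \<Longrightarrow>
        \<exists>a b. a < b \<and> b - a < d \<and> a \<le> x \<and> x \<le> b \<and> G b - G a \<le> p * (b - a)"
  obtains V where "V \<in> sets borel" "E - V \<in> null_sets lborel"
    "emeasure (interval_measure G) V \<le> ennreal p * emeasure lborel U"
proof -
  let ?\<nu> = "interval_measure G"
  obtain C where C: "countable C"
    "\<And>a b. (a, b) \<in> C \<Longrightarrow> a < b \<and> {a..b} \<subseteq> U \<and> G b - G a \<le> p * (b - a)"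
    "disjoint_family_on (\<lambda>(a, b). {a..b}) C"
    "negligible (E - (\<Union>(a, b)\<in>C. {a..b}))"
  proof (rule vitali_interval_cover[OF U(1,2), of "\<lambda>a b. G b - G a \<le> p * (b - a)"])
    fix x d :: real assume "x \<in> E" "0 < d"
    then show "\<exists>a b. a < b \<and> b - a < d \<and> a \<le> x \<and> x \<le> b \<and> G b - G a \<le> p * (b - a)"
      by (rule fine)
  qed (rule that)
  let ?V = "\<Union>(a, b)\<in>C. {a..b}"
  have V: "?V \<in> sets borel" using C(1) by (intro sets.countable_UN'') auto
  have "emeasure ?\<nu> ?V \<le> emeasure (scale_measure (ennreal p) lborel) ?V"
  proof (intro emeasure_intervals_mono C)
    fix a b assume ab: "(a, b) \<in> C"
    then have *: "emeasure ?\<nu> {a..b} = G b - G a"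
      using C(2)[OF ab] G by (intro emeasure_interval_measure_Icc) (auto simp: mono_def)
    have "ennreal (G b - G a) \<le> ennreal (p * (b - a))"
      using C(2)[OF ab] by (intro ennreal_leI) auto
    with * show "emeasure ?\<nu> {a..b} \<le> emeasure (scale_measure (ennreal p) lborel) {a..b}"
      using C(2)[OF ab] by (auto simp: ennreal_mult'')
  qed auto
  also have "\<dots> \<le> ennreal p * emeasure lborel U"
    using C(2) U by (auto intro!: mult_left_mono emeasure_mono)
  finally show thesis
    using V C(2,4) E
    by (intro that[of ?V]) (auto simp: negligible_iff_null_sets null_sets_completion_iff)
qed

lemma AE_finite_slope:
  fixes G :: "real \<Rightarrow> real"
  assumes G: "mono G" "continuous_on UNIV G" and fin: "emeasure (interval_measure G) UNIV \<noteq> \<infinity>"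
    and E: "E \<in> sets borel"
    and fine: "\<And>q x d. x \<in> E \<Longrightarrow> 0 < d \<Longrightarrow>
        \<exists>a b. a < b \<and> b - a < d \<and> a \<le> x \<and> x \<le> b \<and> q * (b - a) \<le> G b - G a"
  shows "emeasure lborel E = 0"
proof -
  have le: "ennreal (real n) * emeasure lborel E \<le> emeasure (interval_measure G) UNIV" for n
  proof -
    have "ennreal (real n) * emeasure lborel E \<le> emeasure (interval_measure G) E"
      using assms by (intro interval_measure_ge_slope) auto
    also have "\<dots> \<le> emeasure (interval_measure G) UNIV" using E by (intro emeasure_mono) auto
    finally show ?thesis .
  qed
  obtain N where N: "emeasure (interval_measure G) UNIV = ennreal N" "0 \<le> N"
    using fin by (cases "emeasure (interval_measure G) UNIV") auto
  have "emeasure lborel E < \<infinity>" using le[of 1] N by (auto simp: less_top[symmetric] top_unique)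
  then obtain m where m: "emeasure lborel E = ennreal m" "0 \<le> m"
    by (cases "emeasure lborel E") auto
  have "real n * m \<le> N" for n
    using le[of n] m N by (simp add: ennreal_mult'[symmetric])
  then have "m = 0"
    using m(2) reals_Archimedean3[of m] by (metis less_eq_real_def not_less)
  then show ?thesis using m by simp
qed

text \<open>
  Lebesgue's argument: \<open>E\<close> is covered, up to a null set, by a set \<open>V\<close> with \<open>\<nu>(V) \<le> p (|E| + e)\<close>. The
  lower bound on \<open>\<nu>\<close> is then applied to \<open>E \<inter> V\<close>, which gives \<open>q |E| = q |E \<inter> V| \<le> \<nu>(V)\<close>. Hence
  \<open>q |E| \<le> p |E|\<close> with \<open>p < q\<close>.
\<close>

lemma null_between_slopes:
  fixes G :: "real \<Rightarrow> real"
  assumes G: "mono G" "continuous_on UNIV G" and fin: "emeasure (interval_measure G) UNIV \<noteq> \<infinity>"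
    and E[measurable]: "E \<in> sets borel" and finE: "emeasure lborel E \<noteq> \<infinity>" and pq: "0 < p" "p < q"
    and lower: "\<And>x d. x \<in> E \<Longrightarrow> 0 < d \<Longrightarrow>
        \<exists>a b. a < b \<and> b - a < d \<and> a \<le> x \<and> x \<le> b \<and> G b - G a \<le> p * (b - a)"
    and upper: "\<And>x d. x \<in> E \<Longrightarrow> 0 < d \<Longrightarrow>
        \<exists>a b. a < b \<and> b - a < d \<and> a \<le> x \<and> x \<le> b \<and> q * (b - a) \<le> G b - G a"
  shows "emeasure lborel E = 0"
proof -
  obtain m where m: "emeasure lborel E = ennreal m" "0 \<le> m"
    using finE by (cases "emeasure lborel E") auto
  have "q * m \<le> p * (m + e)" if e: "0 < e" for e
  proof -
    obtain U where U: "open U" "E \<subseteq> U" "emeasure lborel (U - E) < ennreal e"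
      using outer_regular_lborel[OF E e] by auto
    obtain V where V[measurable]: "V \<in> sets borel" "E - V \<in> null_sets lborel"
      and V_le: "emeasure (interval_measure G) V \<le> ennreal p * emeasure lborel U"
      using interval_measure_le_slope[OF G U(1,2) E lower] by metis
    have [measurable]: "U \<in> sets borel" using U by auto
    have "emeasure lborel E = emeasure lborel ((E \<inter> V) \<union> (E - V))" by (simp add: Int_Diff_Un)
    also have "\<dots> = emeasure lborel (E \<inter> V)"
      using V by (intro emeasure_Un_null_set) auto
    finally have "ennreal q * emeasure lborel E = ennreal q * emeasure lborel (E \<inter> V)" by simp
    also have "\<dots> \<le> emeasure (interval_measure G) (E \<inter> V)"
      using pq by (intro interval_measure_ge_slope[OF G fin] upper) auto
    also have "\<dots> \<le> emeasure (interval_measure G) V" by (intro emeasure_mono) auto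
    also note V_le
    also have "emeasure lborel U \<le> emeasure lborel E + ennreal e"
    proof -
      have "emeasure lborel U = emeasure lborel (E \<union> (U - E))" using U(2) by (simp add: Un_absorb1)
      also have "\<dots> \<le> emeasure lborel E + emeasure lborel (U - E)"
        by (intro emeasure_subadditive) auto
      also have "\<dots> \<le> emeasure lborel E + ennreal e" using U(3) by (intro add_left_mono) auto
      finally show ?thesis .
    qed
    finally have "ennreal q * emeasure lborel E \<le> ennreal p * (emeasure lborel E + ennreal e)"
      by (simp add: mult_left_mono)
    then show ?thesis
      using m pq e by (simp add: ennreal_mult'[symmetric] ennreal_plus[symmetric] del: ennreal_plus)
  qed
  from this[of "e / p" for e] have "q * m \<le> p * m + e" if "0 < e" for e
    using that pq by (simp add: distrib_left)
  then have "q * m \<le> p * m" by (rule field_le_epsilon)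
  then have "m = 0" using pq m(2) by (metis mult_le_cancel_right not_less order_antisym_conv)
  then show ?thesis using m by simp
qed

text \<open>
  The slope between \<open>x\<close> and \<open>y\<close> is symmetric, so a nearby \<open>y\<close> on either side yields an interval
  having \<open>x\<close> as one endpoint.
\<close>

lemma frequently_slope_interval:
  fixes G :: "real \<Rightarrow> real"
  assumes "\<not> (\<forall>\<^sub>F y in at x. \<not> R ((G y - G x) / (y - x)))" "0 < d"
  shows "\<exists>a b. a < b \<and> b - a < d \<and> a \<le> x \<and> x \<le> b \<and> R ((G b - G a) / (b - a))"
proof -
  obtain y where y: "y \<noteq> x" "dist y x < d" "R ((G y - G x) / (y - x))"
    using assms unfolding eventually_at by blast
  show ?thesis
  proof (cases "x < y")
    case True
    then show ?thesis using y by (intro exI[of _ x] exI[of _ y]) (auto simp: dist_real_def)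
  next
    case False
    moreover have "(G x - G y) / (x - y) = (G y - G x) / (y - x)"
      by (metis minus_diff_eq minus_divide_divide)
    ultimately show ?thesis using y by (intro exI[of _ y] exI[of _ x]) (auto simp: dist_real_def)
  qed
qed

text \<open>
  Lebesgue's theorem for continuous monotone functions. Differentiability fails where the upper
  derivate \<open>Up\<close> is infinite or where it exceeds the lower derivate \<open>Lo\<close>. The first set is null since
  the Stieltjes measure is finite, and the second is a countable union over rationals \<open>p < q\<close> and
  bounded windows of the sets treated above.
\<close>

theorem mono_AE_differentiable:
  fixes G :: "real \<Rightarrow> real"
  assumes G: "mono G" "continuous_on UNIV G" and B: "\<And>x. \<bar>G x\<bar> \<le> B"
  shows "AE x in lborel. G differentiable (at x)"
proof -
  let ?\<nu> = "interval_measure G"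
  have "emeasure ?\<nu> UNIV = emeasure ?\<nu> (\<Union>n::nat. {- real n..real n})"
    by (rule arg_cong[where f = "emeasure ?\<nu>"]) (auto, metis abs_le_iff minus_le_iff real_arch_simple)
  also have "\<dots> = (SUP n::nat. emeasure ?\<nu> {- real n..real n})"
    by (rule SUP_emeasure_incseq[symmetric]) (auto simp: incseq_def)
  also have "\<dots> \<le> ennreal (2 * B)"
  proof (rule SUP_least)
    fix n :: nat
    have "emeasure ?\<nu> {- real n..real n} = ennreal (G (real n) - G (- real n))"
      using G by (intro emeasure_interval_measure_Icc) (auto simp: mono_def)
    also have "\<dots> \<le> ennreal (2 * B)"
      using B[of "real n"] B[of "- real n"] by (intro ennreal_leI) auto
    finally show "emeasure ?\<nu> {- real n..real n} \<le> ennreal (2 * B)" .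
  qed
  finally have fin: "emeasure ?\<nu> UNIV \<noteq> \<infinity>" by (auto simp: top_unique)
  define Q where "Q x y = ereal ((G y - G x) / (y - x))" for x y
  define Up where "Up x = Limsup (at x) (Q x)" for x
  define Lo where "Lo x = Liminf (at x) (Q x)" for x
  have cont: "continuous_on A (\<lambda>x. G x)" for A using G(2) continuous_on_subset by blast
  have [measurable]: "Up \<in> borel_measurable borel"
    unfolding Up_def Q_def
    by (intro borel_measurable_Limsup_at continuous_intros cont) auto
  have "Lo = (\<lambda>x. - Limsup (at x) (\<lambda>y. ereal (- ((G y - G x) / (y - x)))))"
    unfolding Lo_def Q_def by (simp add: ereal_Limsup_uminus flip: uminus_ereal.simps(1))
  moreover have "(\<lambda>x. Limsup (at x) (\<lambda>y. ereal (- ((G y - G x) / (y - x))))) \<in> borel_measurable borel"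
    by (intro borel_measurable_Limsup_at continuous_intros cont) auto
  ultimately have [measurable]: "Lo \<in> borel_measurable borel" by simp
  have upper: "\<exists>a b. a < b \<and> b - a < d \<and> a \<le> x \<and> x \<le> b \<and> q * (b - a) \<le> G b - G a"
    if "ereal q < Up x" "0 < d" for q x d
  proof -
    have "\<not> (\<forall>\<^sub>F y in at x. \<not> q < (G y - G x) / (y - x))"
    proof
      assume "\<forall>\<^sub>F y in at x. \<not> q < (G y - G x) / (y - x)"
      then have "Up x \<le> ereal q" unfolding Up_def Q_def by (intro Limsup_bounded) (auto elim: eventually_mono)
      then show False using that by simp
    qed
    from frequently_slope_interval[OF this \<open>0 < d\<close>] show ?thesis
      by (elim exE conjE) (intro exI conjI, assumption+, simp add: field_simps)
  qed
  have lower: "\<exists>a b. a < b \<and> b - a < d \<and> a \<le> x \<and> x \<le> b \<and> G b - G a \<le> p * (b - a)"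
    if "Lo x < ereal p" "0 < d" for p x d
  proof -
    have "\<not> (\<forall>\<^sub>F y in at x. \<not> (G y - G x) / (y - x) < p)"
    proof
      assume "\<forall>\<^sub>F y in at x. \<not> (G y - G x) / (y - x) < p"
      then have "ereal p \<le> Lo x" unfolding Lo_def Q_def by (intro Liminf_bounded) (auto elim: eventually_mono)
      then show False using that by simp
    qed
    from frequently_slope_interval[OF this \<open>0 < d\<close>] show ?thesis
      by (elim exE conjE) (intro exI conjI, assumption+, simp add: field_simps)
  qed
  have "0 \<le> Lo x" for x
    unfolding Lo_def Q_def
  proof (intro Liminf_bounded always_eventually allI)
    fix y show "0 \<le> ereal ((G y - G x) / (y - x))"
      using monoD[OF G(1), of x y] monoD[OF G(1), of y x]
      by (cases "x \<le> y") (auto simp: zero_le_divide_iff)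
  qed
  have "AE x in lborel. Up x < \<infinity>"
  proof (rule AE_I)
    show "emeasure lborel {x. Up x = \<infinity>} = 0"
      using upper by (intro AE_finite_slope[OF G fin]) auto
  qed auto
  moreover have "AE x in lborel. \<forall>p\<in>\<rat>. \<forall>q\<in>\<rat>. \<forall>n::nat. 0 < p \<longrightarrow> p < q \<longrightarrow>
      \<not> (\<bar>x\<bar> \<le> n \<and> Lo x < ereal p \<and> ereal q < Up x)"
  proof (intro AE_ball_countable[THEN iffD2] countable_rat ballI AE_all_countable[THEN iffD2] allI)
    fix p q :: real and n :: nat
    let ?E = "{x::real. \<bar>x\<bar> \<le> n \<and> Lo x < ereal p \<and> ereal q < Up x}"
    have "emeasure lborel ?E = 0" if "0 < p" "p < q"
    proof (rule null_between_slopes[OF G fin _ _ that])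
      have "emeasure lborel ?E \<le> emeasure lborel {- real n..real n}"
        by (intro emeasure_mono) auto
      then show "emeasure lborel ?E \<noteq> \<infinity>" by (auto simp: top_unique)
    qed (auto intro: upper lower)
    then have "AE x in lborel. \<not> (\<bar>x\<bar> \<le> n \<and> Lo x < ereal p \<and> ereal q < Up x)" if "0 < p" "p < q"
      using that by (intro AE_I[where N = ?E]) auto
    then show "AE x in lborel. 0 < p \<longrightarrow> p < q \<longrightarrow> \<not> (\<bar>x\<bar> \<le> n \<and> Lo x < ereal p \<and> ereal q < Up x)"
      by (intro AE_impI)
  qed
  ultimately show ?thesis
  proof eventually_elim
    fix x assume fin: "Up x < \<infinity>" and sep: "\<forall>p\<in>\<rat>. \<forall>q\<in>\<rat>. \<forall>n::nat. 0 < p \<longrightarrow> p < q \<longrightarrow>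
      \<not> (\<bar>x\<bar> \<le> n \<and> Lo x < ereal p \<and> ereal q < Up x)"
    have "Lo x \<le> Up x" unfolding Lo_def Up_def by (intro Liminf_le_Limsup) auto
    moreover have "\<not> Lo x < Up x"
    proof
      assume "Lo x < Up x"
      then obtain c where c: "Lo x < ereal c" "ereal c < Up x"
        using ereal_dense2 by blast
      then obtain c' where c': "ereal c < ereal c'" "ereal c' < Up x"
        using ereal_dense2 by blast
      obtain p where p: "p \<in> \<rat>" "c < p" "p < c'" using Rats_dense_in_real c'(1) by auto
      obtain q where q: "q \<in> \<rat>" "p < q" "q < c'" using Rats_dense_in_real p(3) by auto
      obtain n :: nat where "\<bar>x\<bar> \<le> n" using real_arch_simple by blast
      moreover have "Lo x < ereal p" using c(1) p(2) less_trans less_ereal.simps(1) by metis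
      moreover have "ereal q < Up x" using c'(2) q(3) less_trans less_ereal.simps(1) by metis
      moreover have "0 < p" using \<open>0 \<le> Lo x\<close> \<open>Lo x < ereal p\<close>
        by (metis ereal_less(2) le_less_trans)
      ultimately show False using sep p(1) q(1,2) by blast
    qed
    ultimately have "Lo x = Up x" by simp
    moreover obtain D where D: "Up x = ereal D"
      using fin \<open>0 \<le> Lo x\<close> \<open>Lo x = Up x\<close> by (cases "Up x") auto
    ultimately have "(Q x \<longlongrightarrow> ereal D) (at x)"
      by (subst tendsto_iff_Liminf_eq_Limsup) (auto simp: Lo_def Up_def)
    then have "((\<lambda>y. (G y - G x) / (y - x)) \<longlongrightarrow> D) (at x)" unfolding Q_def by simp
    then have "(G has_field_derivative D) (at x)"
      by (simp add: has_field_derivative_iff)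
    then show "G differentiable (at x)" using real_differentiable_def by blast
  qed
qed

text \<open>
  On an open interval the function may be unbounded near the ends. Clamping the argument to a
  compact subinterval gives a bounded monotone function on the line that agrees with \<open>- g\<close> inside,
  and countably many such subintervals exhaust the interval.
\<close>

corollary antimono_on_AE_differentiable:
  fixes g :: "real \<Rightarrow> real"
  assumes anti: "antimono_on {a<..<b} g" and cont: "continuous_on {a<..<b} g"
  shows "AE x in lborel. x \<in> {a<..<b} \<longrightarrow> g differentiable (at x)"
proof -
  have "AE x in lborel. c < x \<and> x < d \<longrightarrow> g differentiable (at x)"
    if cd: "a < c" "c < d" "d < b" for c d
  proof -
    define G where "G x = - g (max c (min d x))" for x
    have "mono G"
      unfolding G_def mono_def using cd by (auto intro!: monotone_onD[OF anti])
    moreover have "continuous_on UNIV (\<lambda>x. g (max c (min d x)))"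
      using cd by (intro continuous_on_compose2[OF cont] continuous_intros) auto
    then have "continuous_on UNIV G" unfolding G_def by (intro continuous_intros)
    moreover have "\<bar>G x\<bar> \<le> \<bar>G c\<bar> + \<bar>G d\<bar>" for x
    proof -
      have "G c \<le> G x" "G x \<le> G d"
        unfolding G_def using cd by (auto intro!: monotone_onD[OF anti])
      then show ?thesis by linarith
    qed
    ultimately have "AE x in lborel. G differentiable (at x)"
      by (rule mono_AE_differentiable)
    then show ?thesis
    proof eventually_elim
      fix x assume G: "G differentiable (at x)"
      show "c < x \<and> x < d \<longrightarrow> g differentiable (at x)"
      proof
        assume x: "c < x \<and> x < d"
        obtain D where D: "((\<lambda>y. - G y) has_field_derivative D) (at x)"
          using differentiable_minus[OF G] unfolding real_differentiable_def by blast
        have ev: "\<forall>\<^sub>F y in nhds x. - G y = g y"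
          using eventually_nhds_in_open[of "{c<..<d}" x] x
          by (auto simp: G_def elim!: eventually_mono)
        show "g differentiable (at x)"
          unfolding real_differentiable_def
          using DERIV_cong_ev[OF refl _ refl, THEN iffD1, OF ev D] by blast
      qed
    qed
  qed
  then have "AE x in lborel. \<forall>c\<in>\<rat>. \<forall>d\<in>\<rat>. a < c \<longrightarrow> c < d \<longrightarrow> d < b \<longrightarrow> c < x \<and> x < d \<longrightarrow> g differentiable (at x)"
    by (intro AE_ball_countable[THEN iffD2] countable_rat ballI) (intro AE_impI)
  then show ?thesis
  proof eventually_elim
    fix x assume *: "\<forall>c\<in>\<rat>. \<forall>d\<in>\<rat>. a < c \<longrightarrow> c < d \<longrightarrow> d < b \<longrightarrow> c < x \<and> x < d \<longrightarrow> g differentiable (at x)"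
    show "x \<in> {a<..<b} \<longrightarrow> g differentiable (at x)"
    proof
      assume "x \<in> {a<..<b}"
      then have "a < x" "x < b" by auto
      obtain c where c: "c \<in> \<rat>" "a < c" "c < x" using Rats_dense_in_real[OF \<open>a < x\<close>] by auto
      obtain d where d: "d \<in> \<rat>" "x < d" "d < b" using Rats_dense_in_real[OF \<open>x < b\<close>] by auto
      have "c < d" using c d by simp
      with * c d show "g differentiable (at x)" by blast
    qed
  qed
qed

section \<open>Comparing decreasing rearrangements\<close>

text \<open>
  By monotonicity of the distribution function, the levels \<open>\<tau> \<ge> 0\<close> with \<open>s < D \<tau>\<close> form an interval
  from \<open>0\<close> to the infimum of the complementary levels. Writing the rearrangement as the length of
  this interval opens it to Tonelli's theorem.
\<close>

lemma decreasing_rearrangement_eq_emeasure: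
  assumes anti: "antimono (distribution_fun M (\<lambda>x. \<bar>u x\<bar>))"
  shows "decreasing_rearrangement M u s =
    emeasure lborel {\<tau>. 0 \<le> \<tau> \<and> s < distribution_fun M (\<lambda>x. \<bar>u x\<bar>) \<tau>}"
proof -
  let ?D = "distribution_fun M (\<lambda>x. \<bar>u x\<bar>)"
  let ?T = "{\<tau>. 0 \<le> \<tau> \<and> ?D \<tau> \<le> s}" and ?A = "{\<tau>. 0 \<le> \<tau> \<and> s < ?D \<tau>}"
  show ?thesis
  proof (cases "?T = {}")
    case True
    then have "?A = {0..}" by force
    moreover have "emeasure lborel {0::real..} = \<top>"
    proof (rule ccontr)
      assume "emeasure lborel {0::real..} \<noteq> \<top>"
      then obtain r where r: "emeasure lborel {0::real..} = ennreal r" "0 \<le> r"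
        by (cases "emeasure lborel {0::real..}") auto
      have "emeasure lborel {0..r + 1} \<le> emeasure lborel {0::real..}" by (intro emeasure_mono) auto
      then show False using r by simp
    qed
    ultimately show ?thesis unfolding decreasing_rearrangement_def True by simp
  next
    case False
    define c where "c = Inf ?T"
    have bdd: "bdd_below ?T" by (rule bdd_belowI[of _ 0]) auto
    have c0: "0 \<le> c" unfolding c_def using False by (intro cInf_greatest) auto
    have above: "c \<le> \<tau>" if "\<tau> \<in> ?T" for \<tau> unfolding c_def using that bdd by (intro cInf_lower)
    have below: "?D \<tau> \<le> s" if "c < \<tau>" for \<tau>
    proof -
      obtain \<tau>' where "\<tau>' \<in> ?T" "\<tau>' < \<tau>" using cInf_less_iff[OF False bdd, of \<tau>] \<open>c < \<tau>\<close> unfolding c_def by blast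
      then show ?thesis using antimonoD[OF anti, of \<tau>' \<tau>] by simp
    qed
    have lt: "s < ?D \<tau>" if "0 \<le> \<tau>" "\<tau> < c" for \<tau>
      using above[of \<tau>] that by (auto simp: not_le[symmetric])
    have mem: "\<tau> \<in> ?A \<longleftrightarrow> 0 \<le> \<tau> \<and> (\<tau> < c \<or> \<tau> = c \<and> s < ?D c)" for \<tau>
      using lt[of \<tau>] below[of \<tau>] by (cases \<tau> c rule: linorder_cases) auto
    have A: "?A = {0..<c} \<or> ?A = {0..c}"
      unfolding set_eq_iff mem using c0 by (cases "s < ?D c") auto
    have "(INF t\<in>?T. ennreal t) = ennreal c"
    proof (rule antisym)
      show "ennreal c \<le> (INF t\<in>?T. ennreal t)"
        using above by (intro INF_greatest ennreal_leI)
      show "(INF t\<in>?T. ennreal t) \<le> ennreal c"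
      proof (rule ennreal_le_epsilon)
        fix e :: real assume "0 < e"
        then have "(INF t\<in>?T. ennreal t) \<le> ennreal (c + e)"
          using below[of "c + e"] c0 by (intro INF_lower) auto
        then show "(INF t\<in>?T. ennreal t) \<le> ennreal c + ennreal e"
          using c0 \<open>0 < e\<close> by simp
      qed
    qed
    then show ?thesis unfolding decreasing_rearrangement_def using A c0 by auto
  qed
qed

context
  fixes M :: "'a measure" and u :: "'a \<Rightarrow> real" and D :: "real \<Rightarrow> real"
  assumes fin: "finite_measure M" and u[measurable]: "u \<in> borel_measurable M"
  defines "D \<equiv> distribution_fun M (\<lambda>x. \<bar>u x\<bar>)"
begin

lemma distribution_fun_abs_antimono: "antimono D"
  unfolding D_def distribution_fun_def antimono_def
  by (intro allI impI finite_measure.finite_measure_mono[OF fin]) auto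

lemma distribution_fun_abs_measurable [measurable]: "D \<in> borel_measurable borel"
proof -
  have "mono (\<lambda>\<tau>. - D \<tau>)" using distribution_fun_abs_antimono by (auto simp: mono_def antimono_def)
  then have "(\<lambda>\<tau>. - (- D \<tau>)) \<in> borel_measurable borel"
    by (intro borel_measurable_uminus borel_measurable_mono)
  then show ?thesis by simp
qed

lemma nn_integral_decreasing_rearrangement:
  assumes "0 < t"
  shows "(\<integral>\<^sup>+s\<in>{0<..<t}. decreasing_rearrangement M u s \<partial>lborel) =
    (\<integral>\<^sup>+\<tau>\<in>{0..}. min (ennreal t) (ennreal (D \<tau>)) \<partial>lborel)"
proof -
  define S where "S = {(s, \<tau>). 0 < s \<and> s < t \<and> 0 \<le> \<tau> \<and> s < D \<tau>}"
  have "{z \<in> space (borel \<Otimes>\<^sub>M borel). 0 < fst z \<and> fst z < t \<and> 0 \<le> snd z \<and> fst z < D (snd z)} \<in> sets (borel \<Otimes>\<^sub>M borel)"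
    by measurable
  also have "{z \<in> space (borel \<Otimes>\<^sub>M borel). 0 < fst z \<and> fst z < t \<and> 0 \<le> snd z \<and> fst z < D (snd z)} = S"
    by (auto simp: S_def space_pair_measure)
  finally have [measurable]: "S \<in> sets (borel \<Otimes>\<^sub>M borel)" .
  have "(\<integral>\<^sup>+s\<in>{0<..<t}. decreasing_rearrangement M u s \<partial>lborel) =
      (\<integral>\<^sup>+s. \<integral>\<^sup>+\<tau>. indicator S (s, \<tau>) \<partial>lborel \<partial>lborel)"
  proof (rule nn_integral_cong)
    fix s
    have A: "{\<tau>. 0 \<le> \<tau> \<and> s < D \<tau>} \<in> sets lborel"
    proof -
      have "{\<tau> \<in> space borel. 0 \<le> \<tau> \<and> s < D \<tau>} \<in> sets borel" by measurable
      then show ?thesis by simp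
    qed
    have "(\<integral>\<^sup>+\<tau>. indicator S (s, \<tau>) \<partial>lborel) =
        (\<integral>\<^sup>+\<tau>. indicator {\<tau>. 0 \<le> \<tau> \<and> s < D \<tau>} \<tau> * indicator {0<..<t} s \<partial>lborel)"
      by (intro nn_integral_cong) (auto simp: S_def split: split_indicator)
    also have "\<dots> = emeasure lborel {\<tau>. 0 \<le> \<tau> \<and> s < D \<tau>} * indicator {0<..<t} s"
      using A by (subst nn_integral_multc) auto
    also have "\<dots> = decreasing_rearrangement M u s * indicator {0<..<t} s"
      using decreasing_rearrangement_eq_emeasure[OF distribution_fun_abs_antimono[unfolded D_def]]
      unfolding D_def by simp
    finally show "decreasing_rearrangement M u s * indicator {0<..<t} s = (\<integral>\<^sup>+\<tau>. indicator S (s, \<tau>) \<partial>lborel)" ..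
  qed
  also have "\<dots> = (\<integral>\<^sup>+\<tau>. \<integral>\<^sup>+s. indicator S (s, \<tau>) \<partial>lborel \<partial>lborel)"
  proof -
    have "case_prod (\<lambda>s \<tau>. indicator S (s, \<tau>)) \<in> borel_measurable (lborel \<Otimes>\<^sub>M lborel)"
      by (simp add: case_prod_eta cong: measurable_cong_sets sets_pair_measure_cong)
    then show ?thesis by (rule lborel_pair.Fubini'[symmetric])
  qed
  also have "\<dots> = (\<integral>\<^sup>+\<tau>\<in>{0..}. min (ennreal t) (ennreal (D \<tau>)) \<partial>lborel)"
  proof (rule nn_integral_cong)
    fix \<tau>
    have D0: "0 \<le> D \<tau>" unfolding D_def distribution_fun_def by simp
    have "(\<integral>\<^sup>+s. indicator S (s, \<tau>) \<partial>lborel) = (\<integral>\<^sup>+s. indicator {0<..<min t (D \<tau>)} s * indicator {0..} \<tau> \<partial>lborel)"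
      by (intro nn_integral_cong) (auto simp: S_def split: split_indicator)
    also have "\<dots> = ennreal (min t (D \<tau>)) * indicator {0..} \<tau>"
      using D0 assms by (subst nn_integral_multc) auto
    also have "ennreal (min t (D \<tau>)) = min (ennreal t) (ennreal (D \<tau>))"
      using D0 assms by (simp add: min_def)
    finally show "(\<integral>\<^sup>+s. indicator S (s, \<tau>) \<partial>lborel) = min (ennreal t) (ennreal (D \<tau>)) * indicator {0..} \<tau>" .
  qed
  finally show ?thesis .
qed

text \<open>
  Subtraction of extended nonnegative reals is truncated at zero, so the left-hand side is the
  integral of the excess \<open>(|u| - l)\<^sup>+\<close>.
\<close>

lemma nn_integral_excess:
  assumes l: "0 \<le> l"
  shows "(\<integral>\<^sup>+x. ennreal \<bar>u x\<bar> - ennreal l \<partial>M) = (\<integral>\<^sup>+\<tau>\<in>{l..}. ennreal (D \<tau>) \<partial>lborel)"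
proof -
  interpret finite_measure M by fact
  interpret P: pair_sigma_finite lborel M ..
  define S where "S = {(\<tau>, x). l \<le> \<tau> \<and> \<tau> < \<bar>u x\<bar> \<and> x \<in> space M}"
  have "{z \<in> space (lborel \<Otimes>\<^sub>M M). l \<le> fst z \<and> fst z < \<bar>u (snd z)\<bar>} \<in> sets (lborel \<Otimes>\<^sub>M M)"
    by measurable
  also have "{z \<in> space (lborel \<Otimes>\<^sub>M M). l \<le> fst z \<and> fst z < \<bar>u (snd z)\<bar>} = S"
    by (auto simp: S_def space_pair_measure)
  finally have [measurable]: "S \<in> sets (lborel \<Otimes>\<^sub>M M)" .
  have "(\<integral>\<^sup>+x. ennreal \<bar>u x\<bar> - ennreal l \<partial>M) = (\<integral>\<^sup>+x. \<integral>\<^sup>+\<tau>. indicator S (\<tau>, x) \<partial>lborel \<partial>M)"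
  proof (rule nn_integral_cong)
    fix x assume x: "x \<in> space M"
    have "(\<integral>\<^sup>+\<tau>. indicator S (\<tau>, x) \<partial>lborel) = (\<integral>\<^sup>+\<tau>. indicator {l..<\<bar>u x\<bar>} \<tau> \<partial>lborel)"
      using x by (intro nn_integral_cong) (auto simp: S_def split: split_indicator)
    also have "\<dots> = ennreal \<bar>u x\<bar> - ennreal l"
      using l by (cases "l \<le> \<bar>u x\<bar>") (auto simp: ennreal_minus ennreal_neg)
    finally show "ennreal \<bar>u x\<bar> - ennreal l = (\<integral>\<^sup>+\<tau>. indicator S (\<tau>, x) \<partial>lborel)" ..
  qed
  also have "\<dots> = (\<integral>\<^sup>+\<tau>. \<integral>\<^sup>+x. indicator S (\<tau>, x) \<partial>M \<partial>lborel)"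
    by (subst P.Fubini') auto
  also have "\<dots> = (\<integral>\<^sup>+\<tau>\<in>{l..}. ennreal (D \<tau>) \<partial>lborel)"
  proof (rule nn_integral_cong)
    fix \<tau>
    have "(\<integral>\<^sup>+x. indicator S (\<tau>, x) \<partial>M) = (\<integral>\<^sup>+x. indicator {x \<in> space M. \<tau> < \<bar>u x\<bar>} x * indicator {l..} \<tau> \<partial>M)"
      by (intro nn_integral_cong) (auto simp: S_def split: split_indicator)
    also have "\<dots> = emeasure M {x \<in> space M. \<tau> < \<bar>u x\<bar>} * indicator {l..} \<tau>"
      by (subst nn_integral_multc) auto
    also have "\<dots> = ennreal (D \<tau>) * indicator {l..} \<tau>"
      unfolding D_def distribution_fun_def by (simp add: emeasure_eq_measure)
    finally show "(\<integral>\<^sup>+x. indicator S (\<tau>, x) \<partial>M) = ennreal (D \<tau>) * indicator {l..} \<tau>" .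
  qed
  finally show ?thesis .
qed

end

text \<open>
  The integral of the rearrangement up to \<open>t\<close> equals \<open>\<integral>\<^sub>0\<^sup>\<infinity> min(t, D \<tau>) d\<tau>\<close>, and for every level
  \<open>c\<close> this is at most \<open>t c + \<integral>\<^sub>c\<^sup>\<infinity> D \<tau> d\<tau>\<close>, where the second term is the integral of the excess over
  \<open>c\<close>. For \<open>v\<close> there is equality at the level \<open>c\<close> where its distribution function crosses \<open>t\<close>, so
  the comparison of the excesses at this single level suffices.
\<close>

theorem hardy_littlewood_polya:
  fixes u :: "'a \<Rightarrow> real" and v :: "'b \<Rightarrow> real"
  assumes M: "finite_measure M" and u: "u \<in> borel_measurable M"
    and N: "finite_measure N" and v: "v \<in> borel_measurable N"
    and excess: "\<And>l. 0 \<le> l \<Longrightarrow>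
      (\<integral>\<^sup>+x. ennreal \<bar>u x\<bar> - ennreal l \<partial>M) \<le> (\<integral>\<^sup>+x. ennreal \<bar>v x\<bar> - ennreal l \<partial>N)"
    and t: "0 < t"
  shows "(\<integral>\<^sup>+s\<in>{0<..<t}. decreasing_rearrangement M u s \<partial>lborel)
    \<le> (\<integral>\<^sup>+s\<in>{0<..<t}. decreasing_rearrangement N v s \<partial>lborel)"
proof -
  define D where "D = distribution_fun M (\<lambda>x. \<bar>u x\<bar>)"
  define E where "E = distribution_fun N (\<lambda>x. \<bar>v x\<bar>)"
  have [measurable]: "D \<in> borel_measurable borel" "E \<in> borel_measurable borel"
    unfolding D_def E_def using M u N v by (auto intro: distribution_fun_abs_measurable)
  have anti: "antimono E" unfolding E_def using N v by (rule distribution_fun_abs_antimono)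
  have tail: "(\<integral>\<^sup>+\<tau>\<in>{l..}. ennreal (D \<tau>) \<partial>lborel) \<le> (\<integral>\<^sup>+\<tau>\<in>{l..}. ennreal (E \<tau>) \<partial>lborel)" if "0 \<le> l" for l
    using excess[OF that] that unfolding D_def E_def
    by (simp add: nn_integral_excess[OF M u] nn_integral_excess[OF N v])
  have "(\<integral>\<^sup>+\<tau>\<in>{0..}. min (ennreal t) (ennreal (D \<tau>)) \<partial>lborel)
      \<le> (\<integral>\<^sup>+\<tau>\<in>{0..}. min (ennreal t) (ennreal (E \<tau>)) \<partial>lborel)"
  proof (cases "\<exists>\<tau>\<ge>0. E \<tau> \<le> t")
    case False
    then have "min (ennreal t) (ennreal (E \<tau>)) = ennreal t" if "0 \<le> \<tau>" for \<tau>
      using that by (intro min_absorb1 ennreal_leI) force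
    then have "(\<integral>\<^sup>+\<tau>\<in>{0..}. min (ennreal t) (ennreal (E \<tau>)) \<partial>lborel) = (\<integral>\<^sup>+\<tau>\<in>{0::real..}. ennreal t \<partial>lborel)"
      by (intro nn_integral_cong) (auto split: split_indicator)
    then show ?thesis
      by (simp, intro nn_integral_mono) (auto split: split_indicator)
  next
    case True
    define T where "T = {\<tau>. 0 \<le> \<tau> \<and> E \<tau> \<le> t}"
    define c where "c = Inf T"
    have T: "T \<noteq> {}" "bdd_below T" using True by (auto simp: T_def)
    have c0: "0 \<le> c" unfolding c_def using T by (intro cInf_greatest) (auto simp: T_def)
    have below: "t < E \<tau>" if "0 \<le> \<tau>" "\<tau> < c" for \<tau>
      using that cInf_lower[OF _ T(2), of \<tau>] unfolding c_def T_def by force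
    have above: "E \<tau> \<le> t" if "c < \<tau>" for \<tau>
    proof -
      obtain \<tau>' where "\<tau>' \<in> T" "\<tau>' < \<tau>" using cInf_less_iff[OF T, of \<tau>] \<open>c < \<tau>\<close> unfolding c_def by blast
      then show ?thesis using antimonoD[OF anti, of \<tau>' \<tau>] by (simp add: T_def)
    qed
    have "(\<integral>\<^sup>+\<tau>\<in>{0..}. min (ennreal t) (ennreal (D \<tau>)) \<partial>lborel)
        \<le> (\<integral>\<^sup>+\<tau>. ennreal t * indicator {0..<c} \<tau> + ennreal (D \<tau>) * indicator {c..} \<tau> \<partial>lborel)"
      using c0 by (intro nn_integral_mono) (auto split: split_indicator)
    also have "\<dots> = (\<integral>\<^sup>+\<tau>\<in>{0..<c}. ennreal t \<partial>lborel) + (\<integral>\<^sup>+\<tau>\<in>{c..}. ennreal (D \<tau>) \<partial>lborel)"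
      by (intro nn_integral_add) auto
    also have "\<dots> \<le> (\<integral>\<^sup>+\<tau>\<in>{0..<c}. ennreal t \<partial>lborel) + (\<integral>\<^sup>+\<tau>\<in>{c..}. ennreal (E \<tau>) \<partial>lborel)"
      by (intro add_left_mono tail c0)
    also have "\<dots> = (\<integral>\<^sup>+\<tau>. ennreal t * indicator {0..<c} \<tau> + ennreal (E \<tau>) * indicator {c..} \<tau> \<partial>lborel)"
      by (intro nn_integral_add[symmetric]) auto
    also have "\<dots> = (\<integral>\<^sup>+\<tau>\<in>{0..}. min (ennreal t) (ennreal (E \<tau>)) \<partial>lborel)"
    proof (intro nn_integral_cong_AE)
      have "AE \<tau> in lborel. \<tau> \<noteq> c" by (rule AE_lborel_singleton)
      then show "AE \<tau> in lborel. ennreal t * indicator {0..<c} \<tau> + ennreal (E \<tau>) * indicator {c..} \<tau> =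
          min (ennreal t) (ennreal (E \<tau>)) * indicator {0..} \<tau>"
      proof eventually_elim
        case (elim \<tau>)
        consider "\<tau> < 0" | "0 \<le> \<tau>" "\<tau> < c" | "c < \<tau>" using elim by linarith
        then show ?case
        proof cases
          case 2
          then have "ennreal t \<le> ennreal (E \<tau>)" using below[of \<tau>] by (intro ennreal_leI) simp
          then show ?thesis using 2 by (simp add: min_def)
        next
          case 3
          then have "ennreal (E \<tau>) \<le> ennreal t" using above[of \<tau>] by (intro ennreal_leI) simp
          then show ?thesis using 3 c0 by (simp add: min_absorb2)
        qed (use c0 in simp)
      qed
    qed
    finally show ?thesis .
  qed
  then show ?thesis
    unfolding D_def E_def
    by (simp add: nn_integral_decreasing_rearrangement[OF M u t] nn_integral_decreasing_rearrangement[OF N v t])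
qed

section \<open>The signed rearrangement\<close>

context isoperimetric_space
begin

text \<open>
  The Galois connection between a distribution function and its generalised inverse; the direction
  from right to left is right-continuity of the distribution function.
\<close>

lemma less_signed_rearrangement_iff:
  assumes u[measurable]: "u \<in> borel_measurable M" and q: "0 < q" "q < 1"
  shows "s < signed_rearrangement M u q \<longleftrightarrow> q < distribution_fun M u s"
proof -
  interpret D: real_distribution "distr M borel u"
    using u by (rule real_distribution_distr)
  have cdf: "distribution_fun M u s = 1 - cdf (distr M borel u) s" for s
  proof -
    have "{x \<in> space M. u x \<le> s} \<in> sets M" by measurable
    moreover have "{x \<in> space M. s < u x} = space M - {x \<in> space M. u x \<le> s}" by auto
    moreover have "cdf (distr M borel u) s = measure M {x \<in> space M. u x \<le> s}"
      unfolding cdf_def2 by (subst measure_distr) (auto intro!: arg_cong[where f = "measure M"])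
    ultimately show ?thesis unfolding distribution_fun_def by (simp add: prob_compl del: space_M)
  qed
  let ?S = "{s. distribution_fun M u s \<le> q}"
  have "\<forall>\<^sub>F s in at_top. 1 - q < cdf (distr M borel u) s"
    using D.cdf_lim_at_top_prob q by (intro order_tendstoD) auto
  then obtain s1 where "1 - q < cdf (distr M borel u) s1"
    by (metis eventually_at_top_linorder order_refl)
  then have ne: "?S \<noteq> {}" unfolding cdf by (intro exI[of _ s1] ex_in_conv[THEN iffD1]) auto
  have "\<forall>\<^sub>F s in at_bot. cdf (distr M borel u) s < 1 - q"
    using D.cdf_lim_at_bot q by (intro order_tendstoD) auto
  then obtain s2 where s2: "\<And>s. s \<le> s2 \<Longrightarrow> cdf (distr M borel u) s < 1 - q"
    unfolding eventually_at_bot_linorder by auto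
  have bdd: "bdd_below ?S"
  proof (rule bdd_belowI)
    fix s assume "s \<in> ?S"
    then have "\<not> cdf (distr M borel u) s < 1 - q" by (simp add: cdf)
    then show "s2 \<le> s" using s2[of s] by linarith
  qed
  show ?thesis
  proof
    assume less: "s < signed_rearrangement M u q"
    show "q < distribution_fun M u s"
    proof (rule ccontr)
      assume "\<not> q < distribution_fun M u s"
      then have "signed_rearrangement M u q \<le> s"
        unfolding signed_rearrangement_def using bdd by (intro cInf_lower) auto
      with less show False by simp
    qed
  next
    assume "q < distribution_fun M u s"
    then have "cdf (distr M borel u) s < 1 - q" by (simp add: cdf)
    then have "\<forall>\<^sub>F s' in at_right s. cdf (distr M borel u) s' < 1 - q"
      using D.cdf_is_right_cont[of s] unfolding continuous_within by (intro order_tendstoD)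
    then obtain b where b: "s < b" "\<And>s'. s < s' \<Longrightarrow> s' < b \<Longrightarrow> cdf (distr M borel u) s' < 1 - q"
      unfolding eventually_at_right_field by blast
    obtain s' where s': "s < s'" "s' < b" using dense[OF b(1)] by blast
    have "s' \<le> s''" if "s'' \<in> ?S" for s''
    proof (rule ccontr)
      assume "\<not> s' \<le> s''"
      then have "distribution_fun M u s' \<le> distribution_fun M u s''"
        by (intro distribution_fun_antimono u) auto
      then show False using that b(2)[OF s'] by (simp add: cdf)
    qed
    then have "s' \<le> signed_rearrangement M u q"
      unfolding signed_rearrangement_def using ne by (intro cInf_greatest)
    then show "s < signed_rearrangement M u q" using s' by simp
  qed
qed

lemma signed_rearrangement_antimono:
  assumes u: "u \<in> borel_measurable M"
  shows "antimono_on {0<..<1} (signed_rearrangement M u)"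
proof (rule monotone_onI, rule ccontr)
  fix p q :: real assume "p \<in> {0<..<1}" "q \<in> {0<..<1}" "p \<le> q"
    and "\<not> signed_rearrangement M u q \<le> signed_rearrangement M u p"
  then show False
    using less_signed_rearrangement_iff[OF u, of q "signed_rearrangement M u p"]
      less_signed_rearrangement_iff[OF u, of p "signed_rearrangement M u p"] by auto
qed

text \<open>
  The signed rearrangement carries Lebesgue measure on \<open>(0,1)\<close> to the distribution of \<open>u\<close>. By the
  Galois connection both measures agree on half-lines, which determine them.
\<close>

lemma distr_signed_rearrangement:
  assumes u: "u \<in> borel_measurable M" and B: "B \<in> sets borel"
  shows "emeasure lborel {q \<in> {0<..<1}. signed_rearrangement M u q \<in> B} = emeasure M {x \<in> space M. u x \<in> B}"
    and "{q \<in> {0<..<1}. signed_rearrangement M u q \<in> B} \<in> sets borel"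
proof -
  let ?U = "restrict_space lborel {0<..<1::real}" and ?g = "signed_rearrangement M u"
  have level: "{q \<in> space ?U. s < ?g q} = {0<..<distribution_fun M u s}" for s
    using less_signed_rearrangement_iff[OF u] distribution_fun_bounds(2)[of u s]
    by (auto simp: space_restrict_space)
  have "{0<..<distribution_fun M u s} \<in> sets ?U" for s
    using distribution_fun_bounds(2)[of u s]
    by (subst sets_restrict_space_iff) auto
  then have g: "?g \<in> borel_measurable ?U"
    by (intro borel_measurableI_greater) (simp only: level)
  have eq: "distr ?U borel ?g = distr M borel u"
  proof (rule measure_eqI_lessThan)
    fix s
    have M: "emeasure (distr M borel u) {s<..} = ennreal (distribution_fun M u s)"
      using u unfolding distribution_fun_def
      by (simp add: emeasure_distr emeasure_eq_measure vimage_def Int_def conj_commute)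
    have "emeasure (distr ?U borel ?g) {s<..} = emeasure ?U {q \<in> space ?U. s < ?g q}"
      using g by (subst emeasure_distr) (auto intro!: arg_cong[where f = "emeasure ?U"])
    also have "\<dots> = ennreal (distribution_fun M u s)"
      unfolding level using distribution_fun_bounds[of u s]
      by (subst emeasure_restrict_space) auto
    finally show *: "emeasure (distr ?U borel ?g) {s<..} = emeasure (distr M borel u) {s<..}"
      using M by simp
    show "emeasure (distr ?U borel ?g) {s<..} < \<infinity>" unfolding * M by simp
  qed auto
  have set: "?g -` B \<inter> space ?U = {q \<in> {0<..<1}. ?g q \<in> B}" by (auto simp: space_restrict_space)
  have "?g -` B \<inter> space ?U \<in> sets ?U" using g B by (rule measurable_sets)
  then show meas: "{q \<in> {0<..<1}. ?g q \<in> B} \<in> sets borel"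
    unfolding set by (subst (asm) sets_restrict_space_iff) auto
  have "emeasure lborel {q \<in> {0<..<1}. ?g q \<in> B} = emeasure ?U {q \<in> {0<..<1}. ?g q \<in> B}"
    by (subst emeasure_restrict_space) auto
  also have "\<dots> = emeasure (distr ?U borel ?g) B"
    using g B unfolding set[symmetric] by (subst emeasure_distr) auto
  also have "\<dots> = emeasure M {x \<in> space M. u x \<in> B}"
    unfolding eq using u B by (subst emeasure_distr) (auto simp: vimage_def Int_def conj_commute)
  finally show "emeasure lborel {q \<in> {0<..<1}. ?g q \<in> B} = emeasure M {x \<in> space M. u x \<in> B}" .
qed

text \<open>
  For \<open>r\<close> strictly between \<open>g(q)\<close> and \<open>g(p)\<close> the value \<open>\<mu>\<^sub>f(r)\<close> lies in \<open>[p,q]\<close>, where \<open>I\<close> is at least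
  some \<open>m > 0\<close>. The set where \<open>f\<close> takes such values has measure at most \<open>q - p\<close>, so the coarea
  inequality bounds \<open>m (g(p) - g(q))\<close> by \<open>L (q - p)\<close>, with \<open>L\<close> the Lipschitz constant of \<open>f\<close>.
\<close>

lemma signed_rearrangement_locally_lipschitz:
  assumes f: "f \<in> Lip" and ab: "0 < a" "a \<le> b" "b < 1"
  obtains C where "0 \<le> C"
    "\<And>p q. a \<le> p \<Longrightarrow> p \<le> q \<Longrightarrow> q \<le> b \<Longrightarrow>
      \<bar>signed_rearrangement M f p - signed_rearrangement M f q\<bar> \<le> C * (q - p)"
proof -
  obtain L where L: "0 \<le> L" "\<And>x y. \<bar>f x - f y\<bar> \<le> L * dist x y" using Lip_constant[OF f] by blast
  have u[measurable]: "f \<in> borel_measurable M" using f borel_sets by (rule Lip_measurable)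
  let ?g = "signed_rearrangement M f" and ?\<phi> = "distribution_fun M f"
  obtain t0 where t0: "t0 \<in> {a..b}" "\<And>t. t \<in> {a..b} \<Longrightarrow> I t0 \<le> I t"
    using continuous_attains_inf[of "{a..b}" I] continuous_on_subset[OF I_continuous, of "{a..b}"] ab
    by force
  define m where "m = I t0"
  have m: "0 < m" unfolding m_def using t0(1) ab by (intro I_pos) auto
  \<comment> \<open>The values \<open>s'\<close> and \<open>t'\<close> stay away from \<open>g q\<close> and \<open>g p\<close>, at which \<open>f\<close> may have atoms.\<close>
  have main: "m * (t' - s') \<le> L * (q - p)"
    if pq: "a \<le> p" "p \<le> q" "q \<le> b" and st: "?g q < s'" "s' \<le> t'" "t' < ?g p" for p q s' t'
  proof -
    have p01: "0 < p" "p < 1" and q01: "0 < q" "q < 1" using pq ab by auto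
    have range: "?\<phi> r \<in> {a..b}" if "r \<in> {s'..t'}" for r
      using less_signed_rearrangement_iff[OF u p01, of r] less_signed_rearrangement_iff[OF u q01, of r]
        that st pq by auto
    have "ennreal (m * (t' - s')) = (\<integral>\<^sup>+r\<in>{s'..t'}. ennreal m \<partial>lborel)"
      using m st by (simp add: nn_integral_cmult_indicator ennreal_mult')
    also have "\<dots> \<le> (\<integral>\<^sup>+r\<in>{s'..t'}. ennreal (I (?\<phi> r)) \<partial>lborel)"
      using t0(2)[OF range] unfolding m_def
      by (intro nn_integral_mono) (auto intro: ennreal_leI split: split_indicator)
    also have "\<dots> \<le> (\<integral>\<^sup>+x. ennreal (grad_norm f x) * indicator {s'..t'} (f x) \<partial>M)"
      by (intro coarea f) auto
    also have "\<dots> \<le> (\<integral>\<^sup>+x. ennreal L * indicator {x \<in> space M. ?g q < f x \<and> f x \<le> t'} x \<partial>M)"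
      using st grad_norm_le[of f L, OF L(2,1)]
      by (intro nn_integral_mono) (auto intro: ennreal_leI split: split_indicator)
    also have "\<dots> = ennreal L * emeasure M {x \<in> space M. ?g q < f x \<and> f x \<le> t'}"
      by (intro nn_integral_cmult_indicator) measurable
    also have "{x \<in> space M. ?g q < f x \<and> f x \<le> t'} = {x \<in> space M. ?g q < f x} - {x \<in> space M. t' < f x}"
      by auto
    also have "emeasure M \<dots> = ennreal (?\<phi> (?g q) - ?\<phi> t')"
      unfolding distribution_fun_def emeasure_eq_measure using st
      by (subst finite_measure_Diff) auto
    also have "\<dots> \<le> ennreal (q - p)"
      using less_signed_rearrangement_iff[OF u p01, of t'] less_signed_rearrangement_iff[OF u q01, of "?g q"] st
      by (intro ennreal_leI) auto
    finally have "ennreal (m * (t' - s')) \<le> ennreal (L * (q - p))"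
      using L(1) by (simp add: ennreal_mult' mult_left_mono)
    then show ?thesis using L(1) pq by (subst (asm) ennreal_le_iff) auto
  qed
  have "\<bar>?g p - ?g q\<bar> \<le> L / m * (q - p)" if pq: "a \<le> p" "p \<le> q" "q \<le> b" for p q
  proof -
    have ge: "?g q \<le> ?g p" using pq ab by (intro monotone_onD[OF signed_rearrangement_antimono[OF u]]) auto
    have "m * (?g p - ?g q) \<le> L * (q - p)"
    proof (cases "?g q = ?g p")
      case True
      then show ?thesis using L(1) pq by simp
    next
      case False
      with ge have less: "?g q < ?g p" by simp
      show ?thesis
      proof (rule field_le_epsilon)
        fix e :: real assume e: "0 < e"
        define d where "d = min ((?g p - ?g q) / 3) (e / (2 * m))"
        have d: "0 < d" "3 * d \<le> ?g p - ?g q" "2 * m * d \<le> e"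
          using e m less unfolding d_def by (auto simp: min_def field_simps)
        have "m * ((?g p - d) - (?g q + d)) \<le> L * (q - p)"
          using d by (intro main pq) auto
        then show "m * (?g p - ?g q) \<le> L * (q - p) + e" using d(3) by (simp add: algebra_simps)
      qed
    qed
    then show ?thesis using ge m by (simp add: field_simps)
  qed
  then show thesis using that[of "L / m"] L(1) m by simp
qed

lemma signed_rearrangement_continuous:
  assumes f: "f \<in> Lip"
  shows "continuous_on {0<..<1} (signed_rearrangement M f)"
proof (intro continuous_at_imp_continuous_on ballI)
  fix x :: real assume x: "x \<in> {0<..<1}"
  let ?g = "signed_rearrangement M f"
  let ?J = "{x / 2..(x + 1) / 2}"
  obtain C where C: "0 \<le> C" "\<And>p q. x / 2 \<le> p \<Longrightarrow> p \<le> q \<Longrightarrow> q \<le> (x + 1) / 2 \<Longrightarrow> \<bar>?g p - ?g q\<bar> \<le> C * (q - p)"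
    using signed_rearrangement_locally_lipschitz[OF f, of "x / 2" "(x + 1) / 2"] x by auto
  have "C-lipschitz_on ?J ?g"
  proof (rule lipschitz_onI)
    fix p q assume "p \<in> ?J" "q \<in> ?J"
    then show "dist (?g p) (?g q) \<le> C * dist p q"
      using C(2)[of p q] C(2)[of q p] by (cases "p \<le> q") (auto simp: dist_real_def abs_minus_commute)
  qed (rule C)
  then have "continuous_on ?J ?g" by (rule lipschitz_on_continuous_on)
  then show "isCont ?g x"
    by (rule continuous_on_interior) (use x in auto)
qed

lemma signed_rearrangement_locally_absolutely_continuous:
  assumes f: "f \<in> Lip"
  shows "locally_absolutely_continuous_01 (signed_rearrangement M f)"
  unfolding locally_absolutely_continuous_01_def absolutely_continuous_on_interval_def
proof (intro allI impI)
  fix a b \<epsilon> :: real assume ab: "0 < a \<and> a \<le> b \<and> b < 1" and e: "0 < \<epsilon>"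
  let ?g = "signed_rearrangement M f"
  obtain C where C: "0 \<le> C" "\<And>p q. a \<le> p \<Longrightarrow> p \<le> q \<Longrightarrow> q \<le> b \<Longrightarrow> \<bar>?g p - ?g q\<bar> \<le> C * (q - p)"
    using signed_rearrangement_locally_lipschitz[OF f, of a b] ab by metis
  show "\<exists>\<delta>>0. \<forall>D. finite D \<and> (\<forall>(u, v)\<in>D. a \<le> u \<and> u \<le> v \<and> v \<le> b) \<and>
      disjoint_family_on (\<lambda>(u, v). {u<..<v}) D \<and> (\<Sum>(u, v)\<in>D. v - u) < \<delta> \<longrightarrow>
      (\<Sum>(u, v)\<in>D. \<bar>?g v - ?g u\<bar>) < \<epsilon>"
  proof (intro exI[of _ "\<epsilon> / (C + 1)"] conjI allI impI)
    show "0 < \<epsilon> / (C + 1)" using e C(1) by simp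
    fix D :: "(real \<times> real) set"
    assume D: "finite D \<and> (\<forall>(u, v)\<in>D. a \<le> u \<and> u \<le> v \<and> v \<le> b) \<and>
      disjoint_family_on (\<lambda>(u, v). {u<..<v}) D \<and> (\<Sum>(u, v)\<in>D. v - u) < \<epsilon> / (C + 1)"
    have "(\<Sum>(u, v)\<in>D. \<bar>?g v - ?g u\<bar>) \<le> (\<Sum>(u, v)\<in>D. C * (v - u))"
    proof (rule sum_mono)
      fix i assume "i \<in> D"
      then show "(case i of (u, v) \<Rightarrow> \<bar>?g v - ?g u\<bar>) \<le> (case i of (u, v) \<Rightarrow> C * (v - u))"
        using D C(2)[of "fst i" "snd i"] by (auto simp: case_prod_beta abs_minus_commute)
    qed
    also have "\<dots> = C * (\<Sum>(u, v)\<in>D. v - u)" by (simp add: sum_distrib_left case_prod_beta)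
    also have "\<dots> \<le> C * (\<epsilon> / (C + 1))" using D C(1) by (intro mult_left_mono) auto
    also have "\<dots> < \<epsilon>" using e C(1) by (simp add: field_simps)
    finally show "(\<Sum>(u, v)\<in>D. \<bar>?g v - ?g u\<bar>) < \<epsilon>" .
  qed
qed

end

section \<open>The rearrangement inequality\<close>

text \<open>
  The point \<open>x\<close> may be an endpoint of the interval of constancy; a one-sided derivative still
  determines \<open>D\<close>.
\<close>

lemma DERIV_locally_constant:
  fixes g :: "real \<Rightarrow> real"
  assumes D: "(g has_field_derivative D) (at x)" and x: "a < b" "x \<in> {a..b}"
    and const: "\<And>y. y \<in> {a..b} \<Longrightarrow> g y = c"
  shows "D = 0"
proof (rule vector_derivative_unique_within_closed_interval[of a b x g])
  show "(g has_vector_derivative D) (at x within cbox a b)"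
    using D by (auto intro: has_vector_derivative_at_within simp: has_real_derivative_iff_has_vector_derivative)
  show "(g has_vector_derivative 0) (at x within cbox a b)"
    using x const by (intro has_vector_derivative_transform[OF _ _ has_vector_derivative_const[of c]]) auto
qed (use x in auto)

context isoperimetric_space
begin

context
  fixes u :: "'a \<Rightarrow> real" and q D :: real
  assumes u: "u \<in> borel_measurable M" and q: "q \<in> {0<..<1}"
    and D: "(signed_rearrangement M u has_field_derivative D) (at q)" "D \<noteq> 0"
begin

text \<open>
  Two equal values of a monotone function force it to be constant in between, which contradicts a
  nonzero derivative.
\<close>

lemma signed_rearrangement_inj_at:
  assumes q': "q' \<in> {0<..<1}" and eq: "signed_rearrangement M u q' = signed_rearrangement M u q"
  shows "q' = q"
proof (rule ccontr)
  assume "q' \<noteq> q"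
  let ?g = "signed_rearrangement M u"
  have "?g y = ?g q" if y: "y \<in> {min q q'..max q q'}" for y
  proof (rule antisym)
    have "y \<in> {0<..<1}" "min q q' \<le> y" "y \<le> max q q'" using y q q' by auto
    then have "?g y \<le> ?g (min q q')" "?g (max q q') \<le> ?g y"
      using q q' by (auto intro!: monotone_onD[OF signed_rearrangement_antimono[OF u]])
    then show "?g y \<le> ?g q" "?g q \<le> ?g y" using eq by (auto simp: min_def max_def split: if_splits)
  qed
  moreover have "min q q' < max q q'" "q \<in> {min q q'..max q q'}" using \<open>q' \<noteq> q\<close> by auto
  ultimately have "D = 0"
    using DERIV_locally_constant[OF D(1), of "min q q'" "max q q'" "?g q"] by blast
  with D(2) show False ..
qed

lemma distribution_fun_signed_rearrangement: "distribution_fun M u (signed_rearrangement M u q) = q"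
proof (rule antisym)
  let ?g = "signed_rearrangement M u"
  have q01: "0 < q" "q < 1" using q by auto
  show le: "distribution_fun M u (?g q) \<le> q"
    using less_signed_rearrangement_iff[OF u q01, of "?g q"] by simp
  show "q \<le> distribution_fun M u (?g q)"
  proof (rule ccontr)
    assume "\<not> q \<le> distribution_fun M u (?g q)"
    then obtain q' where q': "distribution_fun M u (?g q) < q'" "q' < q" using dense by (auto simp: not_le)
    then have q'01: "0 < q'" "q' < 1" using distribution_fun_bounds(1)[of u "?g q"] q01 by auto
    have "?g q' \<le> ?g q"
      using less_signed_rearrangement_iff[OF u q'01, of "?g q"] q' by auto
    moreover have "?g q \<le> ?g q'"
      using q' q01 q'01 by (intro monotone_onD[OF signed_rearrangement_antimono[OF u]]) auto
    ultimately have "q' = q" using q'01 by (intro signed_rearrangement_inj_at) auto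
    with q' show False by simp
  qed
qed

end

context
  fixes f :: "'a \<Rightarrow> real" and K :: "real set" and g' :: "real \<Rightarrow> real"
  assumes f: "f \<in> Lip" and K: "compact K" "K \<subseteq> {0<..<1}"
    and g': "\<And>q. q \<in> K \<Longrightarrow> (signed_rearrangement M f has_field_derivative g' q) (at q)"
      "\<And>q. q \<in> K \<Longrightarrow> g' q \<noteq> 0"
begin

lemma compact_image_signed_rearrangement: "compact (signed_rearrangement M f ` K)"
  by (rule compact_continuous_image[OF continuous_on_subset[OF signed_rearrangement_continuous[OF f] K(2)] K(1)])

text \<open>
  On \<open>(0,1)\<close> no point outside \<open>K\<close> shares its value with a point of \<open>K\<close>, so \<open>K\<close> is the full preimage
  of its image, and the signed rearrangement transports its measure.
\<close>

lemma emeasure_preimage_image: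
  "emeasure M {x \<in> space M. f x \<in> signed_rearrangement M f ` K} = emeasure lborel K"
proof -
  have u: "f \<in> borel_measurable M" using f borel_sets by (rule Lip_measurable)
  have "q \<in> K" if "q \<in> {0<..<1}" "p \<in> K" "signed_rearrangement M f q = signed_rearrangement M f p" for p q
    using signed_rearrangement_inj_at[OF u _ g'(1)[OF that(2)] g'(2)[OF that(2)] that(1,3)] that(2) K(2) by auto
  then have "K = {q \<in> {0<..<1}. signed_rearrangement M f q \<in> signed_rearrangement M f ` K}"
    using K(2) by auto
  then show ?thesis
    using distr_signed_rearrangement(1)[OF u, of "signed_rearrangement M f ` K"]
      compact_image_signed_rearrangement by (simp add: compact_imp_closed)
qed

text \<open>
  The change of variables \<open>r = g(q)\<close> turns the left-hand side into the integral of \<open>I(\<mu>\<^sub>f(r))\<close> over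
  the compact, hence closed, set \<open>g(K)\<close>, to which the coarea inequality applies.
\<close>

lemma area_le_gradient:
  "(\<integral>\<^sup>+q\<in>K. ennreal (\<bar>g' q\<bar> * I q) \<partial>lborel)
    \<le> (\<integral>\<^sup>+x. ennreal (grad_norm f x) * indicator (signed_rearrangement M f ` K) (f x) \<partial>M)"
proof -
  let ?g = "signed_rearrangement M f" and ?F = "\<lambda>r. I (distribution_fun M f r)"
  have u: "f \<in> borel_measurable M" using f borel_sets by (rule Lip_measurable)
  have [measurable]: "?F \<in> borel_measurable borel" using u by (rule I_distribution_measurable)
  have gK: "?g ` K \<in> sets borel" using compact_image_signed_rearrangement by (simp add: compact_imp_closed)
  have F0: "0 \<le> ?F r" for r using distribution_fun_bounds by (intro I_nonneg)
  have phi: "distribution_fun M f (?g q) = q" if "q \<in> K" for q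
    using that K(2) by (intro distribution_fun_signed_rearrangement[OF u _ g']) auto
  have inj: "inj_on ?g K"
    using phi by (metis inj_onI)
  obtain B where B: "\<forall>t\<in>{0..1}. \<bar>I t\<bar> \<le> B"
    using compact_imp_bounded[OF compact_continuous_image[OF I_continuous compact_Icc]]
    by (auto simp: bounded_iff)
  have FB: "\<bar>?F r\<bar> \<le> \<bar>B\<bar>" for r
    using bspec[OF B, of "distribution_fun M f r"] distribution_fun_bounds[of f r] by auto
  have "integrable lborel (\<lambda>r. indicator (?g ` K) r *\<^sub>R ?F r)"
  proof (rule Bochner_Integration.integrable_bound)
    show "integrable lborel (\<lambda>r. indicator (?g ` K) r *\<^sub>R B)"
      using gK emeasure_compact_finite[OF compact_image_signed_rearrangement]
      by (intro integrable_scaleR_left) (auto simp: integrable_indicator_iff)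
    show "AE r in lborel. norm (indicator (?g ` K) r *\<^sub>R ?F r) \<le> norm (indicator (?g ` K) r *\<^sub>R B)"
      using FB by (intro AE_I2) (auto simp: indicator_def)
  qed (use gK in measurable)
  then have int: "?F absolutely_integrable_on (?g ` K)"
    unfolding set_integrable_def using gK by (subst integrable_completion) auto
  let ?i = "integral (?g ` K) ?F"
  have "(\<lambda>q. \<bar>g' q\<bar> * ?F (?g q)) absolutely_integrable_on K \<and> integral K (\<lambda>q. \<bar>g' q\<bar> * ?F (?g q)) = ?i"
    using has_absolute_integral_change_of_variables_1'[of K ?g g' ?F ?i] int inj g'(1) K(1)
    by (auto intro: has_field_derivative_at_within lmeasurable_compact fmeasurableD)
  then have "((\<lambda>q. \<bar>g' q\<bar> * ?F (?g q)) has_integral ?i) K"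
    using set_lebesgue_integral_eq_integral(1) by (metis has_integral_integral)
  then have "((\<lambda>q. \<bar>g' q\<bar> * I q) has_integral ?i) K"
    by (rule has_integral_eq[rotated]) (simp add: phi)
  then have "(\<integral>\<^sup>+q. ennreal (indicator K q * (\<bar>g' q\<bar> * I q)) \<partial>lborel) = ennreal ?i"
    using K(2) I_nonneg by (intro nn_integral_has_integral_lebesgue) (auto intro!: mult_nonneg_nonneg)
  moreover have "(?F has_integral ?i) (?g ` K)"
    using int set_lebesgue_integral_eq_integral(1) by (metis has_integral_integral)
  then have "(\<integral>\<^sup>+r. ennreal (indicator (?g ` K) r * ?F r) \<partial>lborel) = ennreal ?i"
    using F0 by (intro nn_integral_has_integral_lebesgue)
  moreover have "(\<integral>\<^sup>+q\<in>K. ennreal (\<bar>g' q\<bar> * I q) \<partial>lborel) = (\<integral>\<^sup>+q. ennreal (indicator K q * (\<bar>g' q\<bar> * I q)) \<partial>lborel)"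
    by (intro nn_integral_cong) (auto split: split_indicator)
  moreover have "(\<integral>\<^sup>+r\<in>?g ` K. ennreal (?F r) \<partial>lborel) = (\<integral>\<^sup>+r. ennreal (indicator (?g ` K) r * ?F r) \<partial>lborel)"
    by (intro nn_integral_cong) (auto split: split_indicator)
  ultimately show ?thesis
    using coarea[OF f compact_imp_closed[OF compact_image_signed_rearrangement]] by simp
qed

text \<open>
  Split \<open>|\<nabla>f| \<le> (|\<nabla>f| - l)\<^sup>+ + l\<close>; the constant is integrated over \<open>{f \<in> g(K)}\<close> only, a set whose
  measure is that of \<open>K\<close>.
\<close>

lemma area_le_gradient_excess:
  assumes l: "0 \<le> l"
  shows "(\<integral>\<^sup>+q\<in>K. ennreal (\<bar>g' q\<bar> * I q) \<partial>lborel)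
    \<le> (\<integral>\<^sup>+x. ennreal (grad_norm f x) - ennreal l \<partial>M) + ennreal l * emeasure lborel K"
proof -
  let ?B = "signed_rearrangement M f ` K"
  have [measurable]: "f \<in> borel_measurable M" using f borel_sets by (rule Lip_measurable)
  have [measurable]: "grad_norm f \<in> borel_measurable M" using f borel_sets by (rule grad_norm_measurable)
  have [measurable]: "?B \<in> sets borel" using compact_image_signed_rearrangement by (simp add: compact_imp_closed)
  have "(\<integral>\<^sup>+q\<in>K. ennreal (\<bar>g' q\<bar> * I q) \<partial>lborel) \<le> (\<integral>\<^sup>+x. ennreal (grad_norm f x) * indicator ?B (f x) \<partial>M)"
    by (rule area_le_gradient)
  also have "\<dots> \<le> (\<integral>\<^sup>+x. (ennreal (grad_norm f x) - ennreal l) + ennreal l * indicator {x \<in> space M. f x \<in> ?B} x \<partial>M)"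
  proof (rule nn_integral_mono)
    fix x
    have "ennreal (grad_norm f x) \<le> (ennreal (grad_norm f x) - ennreal l) + ennreal l"
      using grad_norm_nonneg[of f x] l by (simp add: ennreal_minus_if ennreal_plus[symmetric] del: ennreal_plus)
    then show "ennreal (grad_norm f x) * indicator ?B (f x) \<le>
        (ennreal (grad_norm f x) - ennreal l) + ennreal l * indicator {x \<in> space M. f x \<in> ?B} x"
      by (auto split: split_indicator)
  qed
  also have "\<dots> = (\<integral>\<^sup>+x. ennreal (grad_norm f x) - ennreal l \<partial>M) + ennreal l * emeasure M {x \<in> space M. f x \<in> ?B}"
    by (subst nn_integral_add) (auto simp: nn_integral_cmult_indicator)
  finally show ?thesis unfolding emeasure_preimage_image .
qed

end

end

text \<open>
  The value of \<open>deriv\<close> is unspecified where the derivative does not exist, so \<open>deriv h\<close> itself need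
  not be measurable; the limit of difference quotients with increments \<open>1 / Suc n\<close> is Borel and
  agrees with it at the points of differentiability.
\<close>

lemma borel_version_of_deriv:
  fixes h :: "real \<Rightarrow> real"
  assumes h: "(\<lambda>x. indicator {a<..<b} x * h x) \<in> borel_measurable borel"
  obtains w where "w \<in> borel_measurable borel"
    "\<And>x. x \<in> {a<..<b} \<Longrightarrow> h differentiable (at x) \<Longrightarrow> w x = deriv h x"
proof -
  define k where "k x = indicator {a<..<b} x * h x" for x
  have k[measurable]: "k \<in> borel_measurable borel" using h unfolding k_def .
  define w where "w x = lim (\<lambda>n. (k (x + 1 / Suc n) - k x) / (1 / Suc n))" for x
  have "w \<in> borel_measurable borel" unfolding w_def by measurable
  moreover have "w x = deriv h x" if x: "x \<in> {a<..<b}" and diff: "h differentiable (at x)" for x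
  proof -
    obtain D where D: "(h has_field_derivative D) (at x)"
      using diff unfolding real_differentiable_def by blast
    have "\<forall>\<^sub>F y in nhds x. h y = k y"
      using eventually_nhds_in_open[of "{a<..<b}" x] x by (auto simp: k_def elim!: eventually_mono)
    then have "(k has_field_derivative D) (at x)"
      using DERIV_cong_ev[OF refl _ refl, THEN iffD1, OF _ D] by blast
    then have "((\<lambda>t. (k (x + t) - k x) / t) \<longlongrightarrow> D) (at 0)" by (simp add: DERIV_def)
    moreover have "filterlim (\<lambda>n. 1 / real (Suc n)) (at 0) sequentially"
      unfolding filterlim_at using LIMSEQ_Suc[OF lim_1_over_n] by (auto simp: eventually_sequentially)
    ultimately have "(\<lambda>n. (k (x + 1 / Suc n) - k x) / (1 / Suc n)) \<longlonglongrightarrow> D"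
      by (rule filterlim_compose)
    then show ?thesis unfolding w_def using DERIV_imp_deriv[OF D] by (simp add: limI)
  qed
  ultimately show thesis by (rule that)
qed

text \<open>
  A Borel set of reals is an increasing union of compact sets up to a null set. This replaces
  regularity of the measure with density \<open>h\<close>, which need not be locally finite.
\<close>

lemma nn_integral_inner_compact:
  fixes h :: "real \<Rightarrow> ennreal"
  assumes h: "h \<in> borel_measurable borel" and E: "E \<in> sets borel"
    and bound: "\<And>K. compact K \<Longrightarrow> K \<subseteq> E \<Longrightarrow> (\<integral>\<^sup>+x\<in>K. h x \<partial>lborel) \<le> R"
  shows "(\<integral>\<^sup>+x\<in>E. h x \<partial>lborel) \<le> R"
proof -
  have "E \<in> sets lebesgue" using E by simp
  then obtain C T where CT: "fsigma C" "T \<in> null_sets lebesgue" "C \<union> T = E" "disjnt C T"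
    by (rule lebesgue_set_almost_fsigma)
  obtain F :: "nat \<Rightarrow> real set" where F: "range F \<subseteq> Collect compact" "C = \<Union>(range F)"
    using CT(1) fsigma_Union_compact by metis
  define K where "K n = (\<Union>i\<le>n. F i)" for n
  have K: "compact (K n)" "K n \<subseteq> E" for n
    using F CT(3) unfolding K_def by (auto intro!: compact_UN)
  have C: "C = (\<Union>n. K n)" unfolding K_def F(2) by auto
  let ?\<nu> = "density lborel h"
  have \<nu>: "emeasure ?\<nu> A = (\<integral>\<^sup>+x\<in>A. h x \<partial>lborel)" if "A \<in> sets borel" for A
    using h that by (simp add: emeasure_density)
  have Km: "K n \<in> sets borel" for n using K(1) by (simp add: compact_imp_closed)
  have "AE x in lborel. x \<notin> T"
    using AE_not_in[OF CT(2)] by (simp add: AE_completion_iff)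
  then have "(\<integral>\<^sup>+x\<in>E. h x \<partial>lborel) = (\<integral>\<^sup>+x\<in>C. h x \<partial>lborel)"
    using CT(3) by (intro nn_integral_cong_AE) (auto split: split_indicator elim!: eventually_mono)
  also have "\<dots> = emeasure ?\<nu> (\<Union>n. K n)" unfolding C using Km by (intro \<nu>[symmetric]) auto
  also have "\<dots> = (SUP n. emeasure ?\<nu> (K n))"
  proof (rule SUP_emeasure_incseq[symmetric])
    show "incseq K" unfolding K_def by (intro monoI UN_mono) auto
  qed (use Km in auto)
  also have "\<dots> \<le> R"
    using bound[OF K] by (intro SUP_least) (simp add: \<nu>[OF Km])
  finally show ?thesis .
qed

context isoperimetric_space
begin

text \<open>
  By \<open>hardy_littlewood_polya\<close> it suffices to compare the excesses over each level \<open>l \<ge> 0\<close>. On a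
  compact subset of \<open>{|g'| I > l}\<close> this comparison is \<open>area_le_gradient_excess\<close>; there \<open>g' \<noteq> 0\<close> holds
  automatically because \<open>l \<ge> 0\<close>.
\<close>

theorem rearrangement: "rearrangement_inequality M I"
  unfolding rearrangement_inequality_def
proof (intro ballI conjI)
  fix f :: "'a \<Rightarrow> real" assume f: "f \<in> Lip"
  then show "locally_absolutely_continuous_01 (signed_rearrangement M f)"
    by (rule signed_rearrangement_locally_absolutely_continuous)
  fix t :: real assume t: "t \<in> {0<..<1}"
  have fm: "f \<in> borel_measurable M" using f borel_sets by (rule Lip_measurable)
  let ?J = "{0<..<1::real}" and ?g = "signed_rearrangement M f"
  define u where "u q = deriv (\<lambda>q. - ?g q) q * I q" for q
  have cont: "continuous_on ?J ?g" using f by (rule signed_rearrangement_continuous)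
  have "AE q in lborel. q \<in> ?J \<longrightarrow> ?g differentiable (at q)"
    using signed_rearrangement_antimono[OF fm] cont by (rule antimono_on_AE_differentiable)
  then obtain N where N: "\<And>q. q \<notin> N \<Longrightarrow> q \<in> ?J \<Longrightarrow> ?g differentiable (at q)" "N \<in> null_sets lborel"
    by (rule AE_E3) auto
  have N_sets[measurable]: "N \<in> sets borel" using N(2) by auto
  have "(\<lambda>q. indicator ?J q *\<^sub>R - ?g q) \<in> borel_measurable borel"
    using cont by (intro borel_measurable_continuous_on_indicator continuous_intros) auto
  then obtain w where w[measurable]: "w \<in> borel_measurable borel"
    "\<And>q. q \<in> ?J \<Longrightarrow> (\<lambda>q. - ?g q) differentiable (at q) \<Longrightarrow> w q = deriv (\<lambda>q. - ?g q) q"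
    using borel_version_of_deriv[of 0 1 "\<lambda>q. - ?g q"] by auto
  have Im[measurable]: "(\<lambda>q. indicator ?J q *\<^sub>R I q) \<in> borel_measurable borel"
    by (intro borel_measurable_continuous_on_indicator continuous_on_subset[OF I_continuous]) auto
  \<comment> \<open>A Borel function that agrees with \<open>u\<close> on \<open>(0,1)\<close> outside the exceptional null set \<open>N\<close>.\<close>
  define u0 where "u0 q = w q * (indicator ?J q *\<^sub>R I q)" for q
  have u0[measurable]: "u0 \<in> borel_measurable borel" unfolding u0_def by measurable
  have u_eq: "u q = u0 q" if "q \<in> ?J" "q \<notin> N" for q
    using w(2)[OF that(1)] N(1)[OF that(2,1)] that(1) unfolding u_def u0_def
    by (simp add: differentiable_minus)
  have AE_N: "AE q in lborel. q \<notin> N" using N(2) by (rule AE_not_in)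
  have um: "u \<in> borel_measurable (lebesgue_on ?J)"
  proof -
    have "AE q in lebesgue. u0 q = indicator ?J q *\<^sub>R u q"
      using AE_completion[OF AE_N]
      by eventually_elim (auto simp: u_eq u0_def split: split_indicator)
    moreover have "u0 \<in> borel_measurable lebesgue"
      using u0 by (intro measurable_completion) simp
    ultimately have "(\<lambda>q. indicator ?J q *\<^sub>R u q) \<in> borel_measurable lebesgue"
      by (rule borel_measurable_AE[rotated])
    then show ?thesis by (subst borel_measurable_restrict_space_iff) auto
  qed
  have excess: "(\<integral>\<^sup>+q. ennreal \<bar>u q\<bar> - ennreal l \<partial>lebesgue_on ?J)
      \<le> (\<integral>\<^sup>+x. ennreal \<bar>grad_norm f x\<bar> - ennreal l \<partial>M)" if l: "0 \<le> l" for l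
  proof -
    define E where "E = {q \<in> ?J - N. l < \<bar>u0 q\<bar>}"
    have "{q \<in> space borel. q \<in> ?J - N \<and> l < \<bar>u0 q\<bar>} \<in> sets borel" by measurable
    then have E: "E \<in> sets borel" unfolding E_def by simp
    have "(\<integral>\<^sup>+q. ennreal \<bar>u q\<bar> - ennreal l \<partial>lebesgue_on ?J) =
        (\<integral>\<^sup>+q\<in>?J. (ennreal \<bar>u q\<bar> - ennreal l) \<partial>lborel)"
      by (simp add: nn_integral_restrict_space nn_integral_completion)
    also have "\<dots> = (\<integral>\<^sup>+q\<in>E. (ennreal \<bar>u0 q\<bar> - ennreal l) \<partial>lborel)"
      using AE_N
    proof (intro nn_integral_cong_AE, eventually_elim)
      case (elim q)
      have "ennreal \<bar>u0 q\<bar> - ennreal l = 0" if "\<not> l < \<bar>u0 q\<bar>"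
        using that by (simp add: diff_eq_0_iff_ennreal ennreal_leI)
      then show ?case using elim u_eq[of q] by (auto simp: E_def split: split_indicator)
    qed
    also have "\<dots> \<le> (\<integral>\<^sup>+x. ennreal (grad_norm f x) - ennreal l \<partial>M)"
    proof (rule nn_integral_inner_compact)
      fix K assume K: "compact K" "K \<subseteq> E"
      have Km[measurable]: "K \<in> sets borel" using K(1) by (simp add: compact_imp_closed)
      have fin: "ennreal l * emeasure lborel K \<noteq> \<top>"
        using emeasure_compact_finite[OF K(1)] by (simp add: ennreal_mult_eq_top_iff)
      have der: "(?g has_field_derivative deriv ?g q) (at q)" "\<bar>u0 q\<bar> = \<bar>deriv ?g q\<bar> * I q" if "q \<in> K" for q
      proof -
        have q: "q \<in> ?J" "q \<notin> N" using that K(2) by (auto simp: E_def)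
        show D: "(?g has_field_derivative deriv ?g q) (at q)"
          using N(1)[OF q(2,1)] by (metis DERIV_imp_deriv real_differentiable_def)
        have "deriv (\<lambda>q. - ?g q) q = - deriv ?g q"
          using DERIV_minus[OF D] by (rule DERIV_imp_deriv)
        then show "\<bar>u0 q\<bar> = \<bar>deriv ?g q\<bar> * I q"
          using q(1) I_nonneg[of q] unfolding u_eq[OF q, symmetric] u_def by (simp add: abs_mult)
      qed
      have "deriv ?g q \<noteq> 0" if "q \<in> K" for q
        using der(2)[OF that] that K(2) l by (auto simp: E_def)
      then have *: "(\<integral>\<^sup>+q\<in>K. ennreal (\<bar>deriv ?g q\<bar> * I q) \<partial>lborel)
          \<le> (\<integral>\<^sup>+x. ennreal (grad_norm f x) - ennreal l \<partial>M) + ennreal l * emeasure lborel K"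
        using K der(1) l by (intro area_le_gradient_excess f) (auto simp: E_def)
      have "(\<integral>\<^sup>+q\<in>K. (ennreal \<bar>u0 q\<bar> - ennreal l) \<partial>lborel) + ennreal l * emeasure lborel K
          = (\<integral>\<^sup>+q. (ennreal \<bar>u0 q\<bar> - ennreal l) * indicator K q + ennreal l * indicator K q \<partial>lborel)"
        by (subst nn_integral_add) (auto simp: nn_integral_cmult_indicator)
      also have "\<dots> = (\<integral>\<^sup>+q\<in>K. ennreal (\<bar>deriv ?g q\<bar> * I q) \<partial>lborel)"
      proof (intro nn_integral_cong)
        fix q
        have "ennreal \<bar>u0 q\<bar> - ennreal l + ennreal l = ennreal (\<bar>deriv ?g q\<bar> * I q)" if "q \<in> K"
        proof -
          have "ennreal l \<le> ennreal \<bar>u0 q\<bar>" using that K(2) by (intro ennreal_leI) (auto simp: E_def)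
          then show ?thesis using der(2)[OF that] by (simp add: diff_add_cancel_ennreal)
        qed
        then show "(ennreal \<bar>u0 q\<bar> - ennreal l) * indicator K q + ennreal l * indicator K q
            = ennreal (\<bar>deriv ?g q\<bar> * I q) * indicator K q"
          by (auto split: split_indicator)
      qed
      also note *
      finally show "(\<integral>\<^sup>+q\<in>K. (ennreal \<bar>u0 q\<bar> - ennreal l) \<partial>lborel) \<le> (\<integral>\<^sup>+x. ennreal (grad_norm f x) - ennreal l \<partial>M)"
        using fin by (simp add: add.commute)
    qed (use E in measurable)
    finally show ?thesis using grad_norm_nonneg[of f] by simp
  qed
  have "(\<integral>\<^sup>+s\<in>{0<..<t}. decreasing_rearrangement (lebesgue_on ?J) u s \<partial>lborel)
      \<le> (\<integral>\<^sup>+s\<in>{0<..<t}. decreasing_rearrangement M (grad_norm f) s \<partial>lborel)"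
  proof (rule hardy_littlewood_polya)
    show "finite_measure (lebesgue_on ?J)" by (intro finite_measure_lebesgue_on) auto
    show "grad_norm f \<in> borel_measurable M" using f borel_sets by (rule grad_norm_measurable)
  qed (use t um excess finite_measure_axioms in auto)
  then show "(\<integral>\<^sup>+s\<in>{0<..<t}. decreasing_rearrangement (lebesgue_on ?J)
      (\<lambda>r. deriv (\<lambda>q. - ?g q) r * I r) s \<partial>lborel)
      \<le> (\<integral>\<^sup>+s\<in>{0<..<t}. decreasing_rearrangement M (grad_norm f) s \<partial>lborel)"
    unfolding u_def .
qed

end

theorem theorem8:
  fixes M :: "'a::metric_space measure" and I :: "real \<Rightarrow> real"
  assumes "connected (UNIV :: 'a set)"
    and "prob_space M" and "sets M = sets borel"
    and "separable_measure M" and "nonatomic_measure M"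
    and "\<forall>f\<in>Lip. \<forall>c. AE x in M. f x = c \<longrightarrow> grad_norm f x = 0"
    and "convex_isoperimetric_estimator M I"
  shows "(isoperimetric_inequality M I \<longleftrightarrow> ledoux_inequality M I) \<and>
         (ledoux_inequality M I \<longleftrightarrow> rearrangement_inequality M I) \<and>
         (rearrangement_inequality M I \<longleftrightarrow> bobkov_inequality M I)"
proof -
  interpret isoperimetric_space M I
    using assms by (simp add: isoperimetric_space_def isoperimetric_space_axioms_def)
  show ?thesis using isoperimetric ledoux rearrangement bobkov by simp
qed

end
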